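(* Let $R$ be an algebra over an integral domain $\Bbbk$, let $n$ be a natural number, and let $c=\bigoplus_i J_{n_i}(\lambda_i)\in M_n(R)$ be a Jordan-block matrix (so $\sum_i n_i=n$) with eigenvalues $\lambda_i\in\Bbbk$. Then: (i) $S_n(c,R)/R$ is a Frobenius extension if and only if, for every pair $i,j$, $\lambda_i=\lambda_j$ implies $n_i=n_j$. (ii) If every element of $\{1,2,\dots,n\}$ is a unit in $R$, then $S_n(c,R)/R$ is a separable Frobenius extension if and only if $n_i=1$ for every $i$.
   Context: All algebras are associative and unital. $M_n(R)$ is the ring of $n\times n$ matrices over $R$. For $c\in M_n(R)$, the centralizer algebra is $S_n(c,R)=\{a\in M_n(R)\mid ac=ca\}$. The extension $S_n(c,R)/R$ is given by the scalar matrices $R\to S_n(c,R)$, $r\mapsto rI_n$. $J_m(\lambda)$ denotes the $m\times m$ Jordan block with all diagonal entries $\lambda$, ones on the superdiagonal and zeros elsewhere; elements of $\Bbbk$ are regarded as elements of $R$ via the algebra structure. $\bigoplus_i$ denotes the block diagonal direct sum of matrices. An extension of algebras $A/B$ (a unital ring homomorphism $B\to A$) is a Frobenius extension if $A$ is finitely generated projective as a right $B$-module and $A\cong \mathrm{Hom}(A_B,B_B)$ as $B$-$A$-bimodules. It is separable if the multiplication map $A\otimes_B A\to A$ is a split epimorphism of $A$-$A$-bimodules. A separable Frobenius extension is a Frobenius extension that is separable.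
   Formalization: R is assumed nonzero, and for distinct eigenvalues λ_i≠λ_j in 𝕜 the image of λ_i−λ_j in R is assumed not to be a zero divisor; otherwise it fails, e.g. 𝕜=ℚ[t], R=ℚ[t]/(t²), blocks J_1(0), J_1(t). *)

theory Defs
  imports
    "Jordan_Normal_Form.Jordan_Normal_Form"
    "Jordan_Normal_Form.VS_Connect"
    "HOL-Algebra.RingHom"
    "HOL-Algebra.Free_Abelian_Groups"
begin

section \<open>Bimodules\<close>

text \<open>As in \<^const>\<open>free_Abelian_group\<close>, the underlying abelian group of a bimodule is
  stored in a \<^type>\<open>monoid_ext\<close> record: the field \<^const>\<open>monoid.mult\<close> is the addition and
  \<^const>\<open>one\<close> is the zero element.\<close>

record ('l, 'm, 'r) bimodule = "'m monoid" +
  lact :: "'l \<Rightarrow> 'm \<Rightarrow> 'm"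
  ract :: "'m \<Rightarrow> 'r \<Rightarrow> 'm"

definition right_hom ::
    "('b, 'z) ring_scheme \<Rightarrow> ('l, 'm, 'b) bimodule \<Rightarrow> ('k, 'n, 'b) bimodule \<Rightarrow> ('m \<Rightarrow> 'n) set" where
  "right_hom B M N =
     {f \<in> hom M N. \<forall>x\<in>carrier M. \<forall>b\<in>carrier B. f (ract M x b) = ract N (f x) b}"

definition bimodule_hom ::
    "('l, 'y) ring_scheme \<Rightarrow> ('r, 'z) ring_scheme \<Rightarrow>
     ('l, 'm, 'r) bimodule \<Rightarrow> ('l, 'n, 'r) bimodule \<Rightarrow> ('m \<Rightarrow> 'n) set" where
  "bimodule_hom L R M N =
     {f \<in> right_hom R M N. \<forall>a\<in>carrier L. \<forall>x\<in>carrier M. f (lact M a x) = lact N a (f x)}"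

definition bimodule_isomorphic ::
    "('l, 'y) ring_scheme \<Rightarrow> ('r, 'z) ring_scheme \<Rightarrow>
     ('l, 'm, 'r) bimodule \<Rightarrow> ('l, 'n, 'r) bimodule \<Rightarrow> bool" where
  "bimodule_isomorphic L R M N \<longleftrightarrow>
     (\<exists>f\<in>bimodule_hom L R M N. bij_betw f (carrier M) (carrier N))"

definition split_epimorphism ::
    "('l, 'y) ring_scheme \<Rightarrow> ('r, 'z) ring_scheme \<Rightarrow>
     ('l, 'm, 'r) bimodule \<Rightarrow> ('l, 'n, 'r) bimodule \<Rightarrow> ('m \<Rightarrow> 'n) \<Rightarrow> bool" where
  "split_epimorphism L R M N f \<longleftrightarrow>
     f \<in> bimodule_hom L R M N \<and>
     (\<exists>s\<in>bimodule_hom L R N M. \<forall>y\<in>carrier N. f (s y) = y)"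

text \<open>The ring \<open>A\<close>, with scalars acting on the left through \<open>f\<close> and on the right through \<open>g\<close>.\<close>

definition restricted_bimodule ::
    "('a, 'z) ring_scheme \<Rightarrow> ('l \<Rightarrow> 'a) \<Rightarrow> ('r \<Rightarrow> 'a) \<Rightarrow> ('l, 'a, 'r) bimodule" where
  "restricted_bimodule A f g =
     \<lparr>carrier = carrier A, monoid.mult = (\<oplus>\<^bsub>A\<^esub>), one = \<zero>\<^bsub>A\<^esub>,
      lact = (\<lambda>b x. f b \<otimes>\<^bsub>A\<^esub> x), ract = (\<lambda>x b. x \<otimes>\<^bsub>A\<^esub> g b)\<rparr>"

definition free_bimodule ::
    "('b, 'z) ring_scheme \<Rightarrow> nat \<Rightarrow> ('b, nat \<Rightarrow> 'b, 'b) bimodule" where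
  "free_bimodule B m =
     \<lparr>carrier = {..<m} \<rightarrow>\<^sub>E carrier B,
      monoid.mult = (\<lambda>u v. \<lambda>i\<in>{..<m}. u i \<oplus>\<^bsub>B\<^esub> v i),
      one = (\<lambda>i\<in>{..<m}. \<zero>\<^bsub>B\<^esub>),
      lact = (\<lambda>b u. \<lambda>i\<in>{..<m}. b \<otimes>\<^bsub>B\<^esub> u i),
      ract = (\<lambda>u b. \<lambda>i\<in>{..<m}. u i \<otimes>\<^bsub>B\<^esub> b)\<rparr>"

text \<open>Finitely generated projective right modules: retracts (equivalently, up to isomorphism,
  direct summands) of free modules of finite rank.\<close>

definition fg_projective_right ::
    "('b, 'z) ring_scheme \<Rightarrow> ('l, 'm, 'b) bimodule \<Rightarrow> bool" where
  "fg_projective_right B M \<longleftrightarrow>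
     (\<exists>m. \<exists>i\<in>right_hom B M (free_bimodule B m). \<exists>p\<in>right_hom B (free_bimodule B m) M.
        \<forall>x\<in>carrier M. p (i x) = x)"

text \<open>\<open>Hom(M\<^sub>B, B\<^sub>B)\<close> for an \<open>A\<close>-\<open>B\<close>-bimodule \<open>M\<close>, as a \<open>B\<close>-\<open>A\<close>-bimodule: \<open>(b f a)(x) = b f(a x)\<close>.
  Maps are normalized to be \<^const>\<open>undefined\<close> outside the carrier of \<open>M\<close>, so that equality
  of elements is equality of maps on the carrier.\<close>

definition right_dual ::
    "('b, 'z) ring_scheme \<Rightarrow> ('a, 'm, 'b) bimodule \<Rightarrow> ('b, 'm \<Rightarrow> 'b, 'a) bimodule" where
  "right_dual B M =
     \<lparr>carrier =
        right_hom B M (restricted_bimodule B (\<lambda>b. b) (\<lambda>b. b)) \<inter> extensional (carrier M),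
      monoid.mult = (\<lambda>f g. \<lambda>x\<in>carrier M. f x \<oplus>\<^bsub>B\<^esub> g x),
      one = (\<lambda>x\<in>carrier M. \<zero>\<^bsub>B\<^esub>),
      lact = (\<lambda>b f. \<lambda>x\<in>carrier M. b \<otimes>\<^bsub>B\<^esub> f x),
      ract = (\<lambda>f a. \<lambda>x\<in>carrier M. f (lact M a x))\<rparr>"

section \<open>Tensor products over a noncommutative ring\<close>

definition tensor_relations ::
    "('b, 'z) ring_scheme \<Rightarrow> ('l, 'm, 'b) bimodule \<Rightarrow> ('b, 'n, 'r) bimodule \<Rightarrow>
     ('m \<times> 'n \<Rightarrow>\<^sub>0 int) set" where
  "tensor_relations B M N =
     {frag_of (x \<otimes>\<^bsub>M\<^esub> x', y) - frag_of (x, y) - frag_of (x', y) | x x' y.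
        x \<in> carrier M \<and> x' \<in> carrier M \<and> y \<in> carrier N} \<union>
     {frag_of (x, y \<otimes>\<^bsub>N\<^esub> y') - frag_of (x, y) - frag_of (x, y') | x y y'.
        x \<in> carrier M \<and> y \<in> carrier N \<and> y' \<in> carrier N} \<union>
     {frag_of (ract M x b, y) - frag_of (x, lact N b y) | x b y.
        x \<in> carrier M \<and> b \<in> carrier B \<and> y \<in> carrier N}"

definition tensor_kernel ::
    "('b, 'z) ring_scheme \<Rightarrow> ('l, 'm, 'b) bimodule \<Rightarrow> ('b, 'n, 'r) bimodule \<Rightarrow>
     ('m \<times> 'n \<Rightarrow>\<^sub>0 int) set" where
  "tensor_kernel B M N =
     generate (free_Abelian_group (carrier M \<times> carrier N)) (tensor_relations B M N)"

text \<open>Elements of the tensor product are cosets of the subgroup of relations. The outer actions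
  \<open>a (x \<otimes> y) r = a x \<otimes> y r\<close> are given on representatives; \<open>the_elem\<close> picks the common
  value on a coset.\<close>

definition tensor_product ::
    "('b, 'z) ring_scheme \<Rightarrow> ('l, 'm, 'b) bimodule \<Rightarrow> ('b, 'n, 'r) bimodule \<Rightarrow>
     ('l, ('m \<times> 'n \<Rightarrow>\<^sub>0 int) set, 'r) bimodule" where
  "tensor_product B M N =
     (let F = free_Abelian_group (carrier M \<times> carrier N); H = tensor_kernel B M N in
     \<lparr>carrier = carrier (F Mod H), monoid.mult = monoid.mult (F Mod H), one = one (F Mod H),
      lact = (\<lambda>a t. the_elem
        ((\<lambda>z. H #>\<^bsub>F\<^esub> frag_extend (\<lambda>(x, y). frag_of (lact M a x, y)) z) ` t)),
      ract = (\<lambda>t r. the_elem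
        ((\<lambda>z. H #>\<^bsub>F\<^esub> frag_extend (\<lambda>(x, y). frag_of (x, ract N y r)) z) ` t))\<rparr>)"

text \<open>The map \<open>A \<otimes>\<^sub>B A \<rightarrow> A\<close>, \<open>x \<otimes> y \<mapsto> x y\<close>; again \<open>the_elem\<close> picks the common value on a coset.\<close>

definition multiplication_map ::
    "('a, 'z) ring_scheme \<Rightarrow> ('a \<times> 'a \<Rightarrow>\<^sub>0 int) set \<Rightarrow> 'a" where
  "multiplication_map A t = the_elem
     ((\<lambda>z. \<Oplus>\<^bsub>A\<^esub>p\<in>Poly_Mapping.keys z.
            [Poly_Mapping.lookup z p] \<cdot>\<^bsub>A\<^esub> (fst p \<otimes>\<^bsub>A\<^esub> snd p)) ` t)"

section \<open>Frobenius and separable extensions\<close>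

text \<open>An extension \<open>A/B\<close> is given by a unital ring homomorphism \<open>h\<close> from \<open>B\<close> to \<open>A\<close>.\<close>

definition frobenius_extension ::
    "('b, 'y) ring_scheme \<Rightarrow> ('a, 'z) ring_scheme \<Rightarrow> ('b \<Rightarrow> 'a) \<Rightarrow> bool" where
  "frobenius_extension B A h \<longleftrightarrow>
     ring_hom_ring B A h \<and>
     fg_projective_right B (restricted_bimodule A (\<lambda>a. a) h) \<and>
     bimodule_isomorphic B A (restricted_bimodule A h (\<lambda>a. a))
       (right_dual B (restricted_bimodule A (\<lambda>a. a) h))"

definition separable_extension ::
    "('b, 'y) ring_scheme \<Rightarrow> ('a, 'z) ring_scheme \<Rightarrow> ('b \<Rightarrow> 'a) \<Rightarrow> bool" where
  "separable_extension B A h \<longleftrightarrow>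
     ring_hom_ring B A h \<and>
     split_epimorphism A A
       (tensor_product B (restricted_bimodule A (\<lambda>a. a) h) (restricted_bimodule A h (\<lambda>a. a)))
       (restricted_bimodule A (\<lambda>a. a) (\<lambda>a. a))
       (multiplication_map A)"

definition separable_frobenius_extension ::
    "('b, 'y) ring_scheme \<Rightarrow> ('a, 'z) ring_scheme \<Rightarrow> ('b \<Rightarrow> 'a) \<Rightarrow> bool" where
  "separable_frobenius_extension B A h \<longleftrightarrow>
     frobenius_extension B A h \<and> separable_extension B A h"

section \<open>Centralizer matrix algebras\<close>

definition centralizer_algebra :: "nat \<Rightarrow> 'r::ring_1 mat \<Rightarrow> 'r mat ring" where
  "centralizer_algebra n c =
     (ring_mat TYPE('r) n ())\<lparr>carrier := {a \<in> carrier_mat n n. a * c = c * a}\<rparr>"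

definition scalar_matrix :: "nat \<Rightarrow> 'r::ring_1 \<Rightarrow> 'r mat" where
  "scalar_matrix n r = r \<cdot>\<^sub>m 1\<^sub>m n"

text \<open>Algebras over a commutative ring, given by their structure map: a unital ring homomorphism
  with central image.\<close>

definition algebra_structure_map :: "('k::comm_ring_1 \<Rightarrow> 'r::ring_1) \<Rightarrow> bool" where
  "algebra_structure_map \<eta> \<longleftrightarrow>
     \<eta> \<in> ring_hom (class_ring :: 'k ring) (class_ring :: 'r ring) \<and>
     (\<forall>a x. \<eta> a * x = x * \<eta> a)"

end

theory Submission
  imports Defs "HOL-Algebra.Subrings"
begin

text \<open>Write \<open>c = D + N\<close> with \<open>D\<close> diagonal and \<open>N\<close> the strictly upper triangular 0/1 part. A difference of
two distinct eigenvalues annihilates no nonzero element of \<open>R\<close>, so a matrix commutes with \<open>c\<close>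
exactly when it has no entry between distinct eigenvalues and commutes with \<open>N\<close>
(\<open>mem_carrier_A_iff\<close>). Each block of such a matrix is then constant along its diagonals, hence
determined by its first row (\<open>toeplitz_entry\<close>). Both parts of the theorem are read off from this
description, by computations with matrix entries that never need \<open>R\<close> to be commutative.

\<^bold>\<open>Frobenius, from equal sizes.\<close> If blocks with the same eigenvalue have the same size \<open>m\<close>, the entries
in the first rows of the blocks are free coordinates, and each eigenvalue contributes a matrix ring
over \<open>R[x]/(x\<^sup>m)\<close>. The functional \<open>corner_sum\<close> adds up the coefficients of \<open>x\<^bsup>m-1\<^esup>\<close> on the block diagonal. The
evident basis has a dual basis for it, given by \<open>x\<^sup>k \<mapsto> x\<^bsup>m-1-k\<^esup>\<close> and transposition of the two block
indices, so that \<open>a \<mapsto> corner_sum (a \<cdot> _)\<close> is an isomorphism onto the dual (\<open>frobenius_if_equal_sizes\<close>).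

\<^bold>\<open>Equal sizes, from Frobenius.\<close> Suppose that a block of size \<open>p\<close> shares its eigenvalue with a block of
size \<open>q > p\<close>. Let \<open>s\<close> and \<open>t\<close> be the matrix units that send the last basis vector of the larger block to
the first basis vector of the smaller and of the larger block. Both \<open>s\<close> and \<open>t\<close> lie in the
centralizer \<open>A\<close>, and the right ideals \<open>s A\<close> and \<open>t A\<close> are isomorphic through \<open>t x \<mapsto> s x\<close>. The isomorphism
of \<open>A\<close> with its dual makes this map the left multiplication by some \<open>w \<in> A\<close>, so \<open>w t = s\<close>. Hence \<open>w\<close> has
the entry 1 in the top left corner of a block with \<open>p\<close> rows and \<open>q\<close> columns. But a block with fewer
rows than columns is zero on that diagonal (\<open>no_smaller_block_if_frobenius\<close>).

\<^bold>\<open>Separability.\<close> Let \<open>e = \<Sum> u \<otimes> v\<close> be a separability element, \<open>N'\<close> the transpose of \<open>N\<close>, and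
\<open>T = \<Sum> u N' v\<close>. Then \<open>T\<close> commutes with \<open>A\<close>, in particular with \<open>N\<close>. Since \<open>N\<close> is central in \<open>A\<close> and
\<open>N N' N = N\<close>, also \<open>N T N = N \<Sum> u v = N\<close>, whence \<open>N\<^sup>2 T = N\<close>. In a block of size at least 2, the last but
one row of \<open>N\<close> is nonzero, whereas that row of \<open>N\<^sup>2\<close> vanishes (\<open>size_one_if_separable\<close>). If all
sizes are 1, then \<open>A\<close> is a product of full matrix rings, one for each eigenvalue, and
\<open>\<Sum>\<^sub>i E\<^bsub>i,\<rho>(i)\<^esub> \<otimes> E\<^bsub>\<rho>(i),i\<^esub>\<close> is a separability element, where \<open>\<rho>(i)\<close> is a fixed index with the same eigenvalue
as \<open>i\<close> (\<open>separable_if_size_one\<close>).\<close>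

section \<open>The tensor square of a ring extension\<close>

lemma restricted_bimodule_simps [simp]:
  "carrier (restricted_bimodule A f g) = carrier A"
  "monoid.mult (restricted_bimodule A f g) = (\<oplus>\<^bsub>A\<^esub>)"
  "one (restricted_bimodule A f g) = \<zero>\<^bsub>A\<^esub>"
  "lact (restricted_bimodule A f g) b x = f b \<otimes>\<^bsub>A\<^esub> x"
  "ract (restricted_bimodule A f g) x c = x \<otimes>\<^bsub>A\<^esub> g c"
  by (simp_all add: restricted_bimodule_def)

context ring_hom_ring begin

abbreviation "pair_group \<equiv> free_Abelian_group (carrier S \<times> carrier S)"
abbreviation "relations \<equiv> tensor_relations R (restricted_bimodule S (\<lambda>a. a) h) (restricted_bimodule S h (\<lambda>a. a))"
abbreviation "tensor_square \<equiv> tensor_product R (restricted_bimodule S (\<lambda>a. a) h) (restricted_bimodule S h (\<lambda>a. a))"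
abbreviation "relation_group \<equiv> tensor_kernel R (restricted_bimodule S (\<lambda>a. a) h) (restricted_bimodule S h (\<lambda>a. a))"
abbreviation "tensor_class z \<equiv> relation_group #>\<^bsub>pair_group\<^esub> z"

text \<open>The maps out of \<open>S \<times> S\<close> that factor through the tensor product over \<open>R\<close>, with values in an abelian group
\<open>G\<close> that is written multiplicatively as in \<^const>\<open>free_Abelian_group\<close>.\<close>

definition balanced :: "('g, 'x) monoid_scheme \<Rightarrow> ('c \<times> 'c \<Rightarrow> 'g) \<Rightarrow> bool" where
  "balanced G \<beta> \<longleftrightarrow>
     \<beta> \<in> carrier S \<times> carrier S \<rightarrow> carrier G \<and>
     (\<forall>x\<in>carrier S. \<forall>x'\<in>carrier S. \<forall>y\<in>carrier S. \<beta> (x \<oplus>\<^bsub>S\<^esub> x', y) = \<beta> (x, y) \<otimes>\<^bsub>G\<^esub> \<beta> (x', y)) \<and>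
     (\<forall>x\<in>carrier S. \<forall>y\<in>carrier S. \<forall>y'\<in>carrier S. \<beta> (x, y \<oplus>\<^bsub>S\<^esub> y') = \<beta> (x, y) \<otimes>\<^bsub>G\<^esub> \<beta> (x, y')) \<and>
     (\<forall>x\<in>carrier S. \<forall>b\<in>carrier R. \<forall>y\<in>carrier S. \<beta> (x \<otimes>\<^bsub>S\<^esub> h b, y) = \<beta> (x, h b \<otimes>\<^bsub>S\<^esub> y))"

lemma relations_eq: "relations =
     {frag_of (x \<oplus>\<^bsub>S\<^esub> x', y) - frag_of (x, y) - frag_of (x', y) | x x' y.
        x \<in> carrier S \<and> x' \<in> carrier S \<and> y \<in> carrier S} \<union>
     {frag_of (x, y \<oplus>\<^bsub>S\<^esub> y') - frag_of (x, y) - frag_of (x, y') | x y y'.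
        x \<in> carrier S \<and> y \<in> carrier S \<and> y' \<in> carrier S} \<union>
     {frag_of (x \<otimes>\<^bsub>S\<^esub> h b, y) - frag_of (x, h b \<otimes>\<^bsub>S\<^esub> y) | x b y.
        x \<in> carrier S \<and> b \<in> carrier R \<and> y \<in> carrier S}"
  by (simp add: tensor_relations_def)

lemma pair_group_closed:
  assumes "z \<in> carrier pair_group" "w \<in> carrier pair_group"
  shows "z + w \<in> carrier pair_group" "z - w \<in> carrier pair_group"
  using assms keys_add[of z w] keys_diff[of z w] by auto

lemma relations_subset: "relations \<subseteq> carrier pair_group"
  unfolding relations_eq by (auto dest!: subsetD[OF keys_diff])

lemma relation_group_subgroup: "subgroup relation_group pair_group"
  unfolding tensor_kernel_def
  using group.generate_is_subgroup[OF group_free_Abelian_group relations_subset]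
  by simp

lemma relation_group_normal: "relation_group \<lhd> pair_group"
  using relation_group_subgroup comm_group.normal_iff_subgroup abelian_free_Abelian_group by blast

lemma hom_eq_on_generators:
  assumes G: "group G" and f: "f \<in> hom pair_group G" and g: "g \<in> hom pair_group G"
    and eq: "\<And>x y. x \<in> carrier S \<Longrightarrow> y \<in> carrier S \<Longrightarrow> f (frag_of (x, y)) = g (frag_of (x, y))"
    and z: "z \<in> carrier pair_group"
  shows "f z = g z"
proof -
  interpret f: group_hom pair_group G f using f G by (simp add: group_hom_def group_hom_axioms_def)
  interpret g: group_hom pair_group G g using g G by (simp add: group_hom_def group_hom_axioms_def)
  from z have "Poly_Mapping.keys z \<subseteq> carrier S \<times> carrier S" by simp
  then show ?thesis
  proof (rule free_Abelian_group_induct[where P = "\<lambda>z. f z = g z"])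
    show "f 0 = g 0" using f.hom_one g.hom_one by simp
  next
    fix x y :: "'c \<times> 'c \<Rightarrow>\<^sub>0 int"
    assume xy: "Poly_Mapping.keys x \<subseteq> carrier S \<times> carrier S" "Poly_Mapping.keys y \<subseteq> carrier S \<times> carrier S"
      "f x = g x" "f y = g y"
    then have c: "x \<in> carrier pair_group" "y \<in> carrier pair_group" by simp_all
    then have "f (x \<otimes>\<^bsub>pair_group\<^esub> inv\<^bsub>pair_group\<^esub> y) = g (x \<otimes>\<^bsub>pair_group\<^esub> inv\<^bsub>pair_group\<^esub> y)"
      using xy f.hom_mult[OF c(1) f.G.inv_closed[OF c(2)]] g.hom_mult[OF c(1) f.G.inv_closed[OF c(2)]]
        f.hom_inv[OF c(2)] g.hom_inv[OF c(2)] by (simp only:)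
    then show "f (x - y) = g (x - y)" using xy by simp
  qed (use eq in auto)
qed

lemma balanced_hom_kills_kernel:
  assumes G: "group G" and f: "f \<in> hom pair_group G" and bal: "balanced G (\<lambda>p. f (frag_of p))"
    and z: "z \<in> relation_group"
  shows "f z = \<one>\<^bsub>G\<^esub>"
proof -
  interpret f: group_hom pair_group G f using f G by (simp add: group_hom_def group_hom_axioms_def)
  have diff: "f (a - b) = f a \<otimes>\<^bsub>G\<^esub> inv\<^bsub>G\<^esub> f b" if "a \<in> carrier pair_group" "b \<in> carrier pair_group" for a b
    using f.hom_mult[of a "inv\<^bsub>pair_group\<^esub> b"] that f.hom_inv[of b] by simp
  have dc: "a - b \<in> carrier pair_group" if "a \<in> carrier pair_group" "b \<in> carrier pair_group" for a b :: "'c \<times> 'c \<Rightarrow>\<^sub>0 int"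
    using keys_diff[of a b] that by auto
  have rel: "f r = \<one>\<^bsub>G\<^esub>" if "r \<in> relations" for r
    using that unfolding relations_eq
  proof (elim UnE CollectE exE conjE)
    fix x x' y assume r: "r = frag_of (x \<oplus>\<^bsub>S\<^esub> x', y) - frag_of (x, y) - frag_of (x', y)"
      and c: "x \<in> carrier S" "x' \<in> carrier S" "y \<in> carrier S"
    have "frag_of (x,y) \<in> carrier pair_group" "frag_of (x',y) \<in> carrier pair_group" "frag_of (x \<oplus>\<^bsub>S\<^esub> x', y) \<in> carrier pair_group"
      using c by auto
    moreover have "f (frag_of (x \<oplus>\<^bsub>S\<^esub> x', y)) = f (frag_of (x', y)) \<otimes>\<^bsub>G\<^esub> f (frag_of (x, y))"
      using bal c S.a_comm[of x x'] unfolding balanced_def by metis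
    ultimately show ?thesis unfolding r
      by (simp only: diff dc f.hom_closed f.H.m_assoc f.H.r_inv f.H.inv_closed f.H.r_one)
  next
    fix x y y' assume r: "r = frag_of (x, y \<oplus>\<^bsub>S\<^esub> y') - frag_of (x, y) - frag_of (x, y')"
      and c: "x \<in> carrier S" "y \<in> carrier S" "y' \<in> carrier S"
    have "frag_of (x,y) \<in> carrier pair_group" "frag_of (x,y') \<in> carrier pair_group" "frag_of (x, y \<oplus>\<^bsub>S\<^esub> y') \<in> carrier pair_group"
      using c by auto
    moreover have "f (frag_of (x, y \<oplus>\<^bsub>S\<^esub> y')) = f (frag_of (x, y')) \<otimes>\<^bsub>G\<^esub> f (frag_of (x, y))"
      using bal c S.a_comm[of y y'] unfolding balanced_def by metis
    ultimately show ?thesis unfolding r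
      by (simp only: diff dc f.hom_closed f.H.m_assoc f.H.r_inv f.H.inv_closed f.H.r_one)
  next
    fix x b y assume r: "r = frag_of (x \<otimes>\<^bsub>S\<^esub> h b, y) - frag_of (x, h b \<otimes>\<^bsub>S\<^esub> y)"
      and c: "x \<in> carrier S" "b \<in> carrier R" "y \<in> carrier S"
    have "frag_of (x \<otimes>\<^bsub>S\<^esub> h b, y) \<in> carrier pair_group" "frag_of (x, h b \<otimes>\<^bsub>S\<^esub> y) \<in> carrier pair_group"
      using c by auto
    moreover have "f (frag_of (x \<otimes>\<^bsub>S\<^esub> h b, y)) = f (frag_of (x, h b \<otimes>\<^bsub>S\<^esub> y))"
      using bal c unfolding balanced_def by metis
    ultimately show ?thesis unfolding r
      by (simp only: diff dc f.hom_closed f.H.m_assoc f.H.r_inv f.H.inv_closed f.H.r_one)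
  qed
  have pg: "free_Abelian_group (carrier (restricted_bimodule S (\<lambda>a. a) h) \<times> carrier (restricted_bimodule S h (\<lambda>a. a))) = pair_group"
    by simp
  have "z \<in> carrier pair_group \<and> f z = \<one>\<^bsub>G\<^esub>" using z unfolding tensor_kernel_def pg
  proof (induct rule: generate.induct)
    case one then show ?case using f.hom_one by simp
  next
    case (incl r) then show ?case using rel relations_subset by blast
  next
    case (inv r) 
    then have "r \<in> carrier pair_group" using relations_subset by blast
    then show ?case using rel[OF inv] f.hom_inv[of r] by (simp add: f.H.inv_one del: inv_free_Abelian_group carrier_free_Abelian_group_iff)
  next
    case (eng a b) then show ?case using f.hom_mult[of a b] 
       by (simp del: mult_free_Abelian_group carrier_free_Abelian_group_iff)
  qed
  then show ?thesis by simp
qed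

text \<open>The actions on the tensor product and the multiplication map are the common values of a homomorphism
on cosets. The homomorphism is constant there because balancedness makes it kill the relations.\<close>

lemma the_elem_balanced_image:
  assumes "group G" "f \<in> hom pair_group G" "balanced G (\<lambda>p. f (frag_of p))" "z \<in> carrier pair_group"
  shows "the_elem (f ` tensor_class z) = f z"
proof -
  interpret f: group_hom pair_group G f using assms by (simp add: group_hom_def group_hom_axioms_def)
  have "f x = f z" if "x \<in> tensor_class z" for x
  proof -
    from that obtain k where k: "k \<in> relation_group" "x = k \<otimes>\<^bsub>pair_group\<^esub> z" by (auto simp: r_coset_def)
    moreover have "k \<in> carrier pair_group" using k subgroup.subset[OF relation_group_subgroup] by blast
    ultimately show ?thesis using f.hom_mult[of k z] balanced_hom_kills_kernel[OF assms(1-3) k(1)] assms(4)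
      by (simp del: mult_free_Abelian_group carrier_free_Abelian_group_iff)
  qed
  moreover have "z \<in> tensor_class z" using assms(4) relation_group_subgroup
    by (meson group_free_Abelian_group group.rcos_self)
  ultimately have "f ` tensor_class z = {f z}" by blast
  then show ?thesis by simp
qed

text \<open>The formula has the shape of \<^const>\<open>multiplication_map\<close>, which is recovered by taking for \<open>G\<close> the additive
group of \<open>S\<close> and for \<open>\<beta>\<close> the product.\<close>

definition lift :: "('g, 'x) monoid_scheme \<Rightarrow> ('c \<times> 'c \<Rightarrow> 'g) \<Rightarrow> ('c \<times> 'c \<Rightarrow>\<^sub>0 int) \<Rightarrow> 'g" where
  "lift G \<beta> z = finprod G (\<lambda>p. \<beta> p [^]\<^bsub>G\<^esub> Poly_Mapping.lookup z p) (Poly_Mapping.keys z)"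

lemma lift_hom:
  assumes "comm_group G" "\<beta> \<in> carrier S \<times> carrier S \<rightarrow> carrier G"
  shows "lift G \<beta> \<in> hom pair_group G"
proof -
  interpret G: comm_group G by fact
  have \<beta>: "\<beta> p [^]\<^bsub>G\<^esub> (k::int) \<in> carrier G" if "p \<in> carrier S \<times> carrier S" for p k 
    using assms(2) that by blast
  \<comment> \<open>Summing over a common finite superset of the supports makes two lifts comparable.\<close>
  have larger: "lift G \<beta> z = finprod G (\<lambda>p. \<beta> p [^]\<^bsub>G\<^esub> Poly_Mapping.lookup z p) K"
    if "Poly_Mapping.keys z \<subseteq> K" "K \<subseteq> carrier S \<times> carrier S" "finite K" for z K
    unfolding lift_def
    by (rule G.finprod_mono_neutral_cong_left) (use that \<beta> in \<open>auto simp: in_keys_iff\<close>)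
  show ?thesis
  proof (rule homI)
    fix z assume "z \<in> carrier pair_group" then show "lift G \<beta> z \<in> carrier G"
      unfolding lift_def using \<beta> by (auto intro!: G.finprod_closed)
  next
    fix z w assume zw: "z \<in> carrier pair_group" "w \<in> carrier pair_group"
    define K where "K = Poly_Mapping.keys z \<union> Poly_Mapping.keys w"
    have K: "finite K" "K \<subseteq> carrier S \<times> carrier S" "Poly_Mapping.keys z \<subseteq> K" "Poly_Mapping.keys w \<subseteq> K"
      "Poly_Mapping.keys (z + w) \<subseteq> K"
      using zw keys_add[of z w] by (auto simp: K_def)
    have "finprod G (\<lambda>p. \<beta> p [^]\<^bsub>G\<^esub> Poly_Mapping.lookup (z + w) p) K
      = finprod G (\<lambda>p. \<beta> p [^]\<^bsub>G\<^esub> Poly_Mapping.lookup z p \<otimes>\<^bsub>G\<^esub> \<beta> p [^]\<^bsub>G\<^esub> Poly_Mapping.lookup w p) K"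
      using K assms(2) \<beta> by (intro G.finprod_cong') (auto simp: lookup_add G.int_pow_mult Pi_iff)
    also have "\<dots> = finprod G (\<lambda>p. \<beta> p [^]\<^bsub>G\<^esub> Poly_Mapping.lookup z p) K \<otimes>\<^bsub>G\<^esub> 
      finprod G (\<lambda>p. \<beta> p [^]\<^bsub>G\<^esub> Poly_Mapping.lookup w p) K"
      using K \<beta> by (intro G.finprod_multf) auto
    finally show "lift G \<beta> (z \<otimes>\<^bsub>pair_group\<^esub> w) = lift G \<beta> z \<otimes>\<^bsub>G\<^esub> lift G \<beta> w"
      using K by (simp add: larger)
  qed
qed

lemma lift_frag_of:
  assumes "comm_group G" "\<beta> p \<in> carrier G"
  shows "lift G \<beta> (frag_of p) = \<beta> p"
proof -
  interpret G: comm_group G by fact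
  show ?thesis using assms(2) by (simp add: lift_def G.finprod_insert)
qed

lemma balanced_lift:
  assumes "comm_group G" "balanced G \<beta>"
  shows "balanced G (\<lambda>p. lift G \<beta> (frag_of p))"
proof -
  have "lift G \<beta> (frag_of (x, y)) = \<beta> (x, y)" if "x \<in> carrier S" "y \<in> carrier S" for x y
    using assms(2) that by (intro lift_frag_of[OF assms(1)]) (auto simp: balanced_def)
  with assms(2) show ?thesis by (auto simp: balanced_def Pi_iff)
qed

definition act_left :: "'c \<Rightarrow> ('c \<times> 'c \<Rightarrow>\<^sub>0 int) \<Rightarrow> ('c \<times> 'c \<Rightarrow>\<^sub>0 int)" where
  "act_left a = frag_extend (\<lambda>(x, y). frag_of (a \<otimes>\<^bsub>S\<^esub> x, y))"

definition act_right :: "'c \<Rightarrow> ('c \<times> 'c \<Rightarrow>\<^sub>0 int) \<Rightarrow> ('c \<times> 'c \<Rightarrow>\<^sub>0 int)" where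
  "act_right a = frag_extend (\<lambda>(x, y). frag_of (x, y \<otimes>\<^bsub>S\<^esub> a))"

lemma tensor_class_eqI: 
  assumes "z \<in> carrier pair_group" "w \<in> carrier pair_group" "z - w \<in> relation_group"
  shows "tensor_class z = tensor_class w"
proof -
  have "z \<in> tensor_class w" using assms(3) by (force simp: r_coset_def)
  then show ?thesis using group.repr_independence[OF group_free_Abelian_group _ assms(2) relation_group_subgroup] by simp
qed

lemma tensor_class_add:
  assumes "z \<in> carrier pair_group" "w \<in> carrier pair_group"
  shows "tensor_class (z + w) = tensor_class z \<otimes>\<^bsub>pair_group Mod relation_group\<^esub> tensor_class w"
  using normal.rcos_sum[OF relation_group_normal assms] by simp

lemma tensor_class_hom: "tensor_class \<in> hom pair_group (pair_group Mod relation_group)"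
  by (rule normal.r_coset_hom_Mod[OF relation_group_normal])

lemma group_Mod: "comm_group (pair_group Mod relation_group)"
  using abelian_free_Abelian_group relation_group_subgroup comm_group.abelian_FactGroup by blast

lemma relation_in_relation_group: "r \<in> relations \<Longrightarrow> r \<in> relation_group"
  unfolding tensor_kernel_def by (rule generate.incl)

lemma relation_group_zero: "0 \<in> relation_group"
  using subgroup.one_closed[OF relation_group_subgroup] by simp

lemma relation_group_add: "z \<in> relation_group \<Longrightarrow> w \<in> relation_group \<Longrightarrow> z + w \<in> relation_group"
  using subgroup.m_closed[OF relation_group_subgroup] by simp

lemma relation_group_diff_swap:
  assumes "z - w \<in> relation_group"
  shows "w - z \<in> relation_group"
proof -
  have "z - w \<in> carrier pair_group" using assms subgroup.subset[OF relation_group_subgroup] by blast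
  then show ?thesis using subgroup.m_inv_closed[OF relation_group_subgroup assms] by simp
qed

lemma relation_group_sum:
  assumes "\<And>i. i \<in> I \<Longrightarrow> z i - w i \<in> relation_group"
  shows "(\<Sum>i\<in>I. z i) - (\<Sum>i\<in>I. w i) \<in> relation_group"
  unfolding sum_subtractf[symmetric] using assms
  by (induct I rule: infinite_finite_induct) (auto intro: relation_group_zero relation_group_add)

lemma relation_group_add_left:
  assumes "x \<in> carrier S" "x' \<in> carrier S" "y \<in> carrier S"
  shows "frag_of (x \<oplus>\<^bsub>S\<^esub> x', y) - frag_of (x, y) - frag_of (x', y) \<in> relation_group"
  using assms by (intro relation_in_relation_group) (simp only: relations_eq, blast)

lemma relation_group_add_right:
  assumes "x \<in> carrier S" "y \<in> carrier S" "y' \<in> carrier S"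
  shows "frag_of (x, y \<oplus>\<^bsub>S\<^esub> y') - frag_of (x, y) - frag_of (x, y') \<in> relation_group"
  using assms by (intro relation_in_relation_group) (simp only: relations_eq, blast)

lemma relation_group_middle:
  assumes "x \<in> carrier S" "b \<in> carrier R" "y \<in> carrier S"
  shows "frag_of (x \<otimes>\<^bsub>S\<^esub> h b, y) - frag_of (x, h b \<otimes>\<^bsub>S\<^esub> y) \<in> relation_group"
  using assms by (intro relation_in_relation_group) (simp only: relations_eq, blast)

text \<open>The empty sum is covered since \<open>0 \<otimes> y = 0 \<otimes> y + 0 \<otimes> y\<close> already makes \<open>0 \<otimes> y\<close> a relation.\<close>

lemma relation_group_finsum_left:
  assumes "finite I" "x \<in> I \<rightarrow> carrier S" "y \<in> carrier S"
  shows "frag_of (finsum S x I, y) - (\<Sum>i\<in>I. frag_of (x i, y)) \<in> relation_group"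
  using assms(1,2)
proof (induct rule: finite_induct)
  case empty
  show ?case using relation_group_diff_swap[of 0 "frag_of (\<zero>\<^bsub>S\<^esub>, y)"] relation_group_add_left[of "\<zero>\<^bsub>S\<^esub>" "\<zero>\<^bsub>S\<^esub>" y] assms(3) by simp
next
  case (insert k I)
  have "frag_of (x k \<oplus>\<^bsub>S\<^esub> finsum S x I, y) - frag_of (x k, y) - frag_of (finsum S x I, y) \<in> relation_group"
    using insert assms(3) by (intro relation_group_add_left) auto
  from relation_group_add[OF this insert(3)] show ?case
    using insert by (simp add: S.finsum_insert algebra_simps Pi_iff)
qed

lemma relation_group_finsum_right:
  assumes "finite I" "y \<in> I \<rightarrow> carrier S" "x \<in> carrier S"
  shows "frag_of (x, finsum S y I) - (\<Sum>i\<in>I. frag_of (x, y i)) \<in> relation_group"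
  using assms(1,2)
proof (induct rule: finite_induct)
  case empty
  show ?case using relation_group_diff_swap[of 0 "frag_of (x, \<zero>\<^bsub>S\<^esub>)"] relation_group_add_right[of x "\<zero>\<^bsub>S\<^esub>" "\<zero>\<^bsub>S\<^esub>"] assms(3) by simp
next
  case (insert k I)
  have "frag_of (x, y k \<oplus>\<^bsub>S\<^esub> finsum S y I) - frag_of (x, y k) - frag_of (x, finsum S y I) \<in> relation_group"
    using insert assms(3) by (intro relation_group_add_right) auto
  from relation_group_add[OF this insert(3)] show ?case
    using insert by (simp add: S.finsum_insert algebra_simps Pi_iff)
qed

lemma balanced_tensor_class: "balanced (pair_group Mod relation_group) (\<lambda>p. tensor_class (frag_of p))"
  unfolding balanced_def
proof (intro conjI ballI)
  show "(\<lambda>p. tensor_class (frag_of p)) \<in> carrier S \<times> carrier S \<rightarrow> carrier (pair_group Mod relation_group)"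
    using hom_in_carrier[OF tensor_class_hom] by auto
next
  fix x x' y assume c: "x \<in> carrier S" "x' \<in> carrier S" "y \<in> carrier S"
  then have "frag_of (x \<oplus>\<^bsub>S\<^esub> x', y) - (frag_of (x, y) + frag_of (x', y)) \<in> relation_group"
    using relation_group_add_left by (simp only: diff_diff_eq)
  then show "tensor_class (frag_of (x \<oplus>\<^bsub>S\<^esub> x', y)) = tensor_class (frag_of (x, y)) \<otimes>\<^bsub>pair_group Mod relation_group\<^esub> tensor_class (frag_of (x', y))"
    using c by (subst tensor_class_add[symmetric]; (intro tensor_class_eqI pair_group_closed)?) simp_all
next
  fix x y y' assume c: "x \<in> carrier S" "y \<in> carrier S" "y' \<in> carrier S"
  then have "frag_of (x, y \<oplus>\<^bsub>S\<^esub> y') - (frag_of (x, y) + frag_of (x, y')) \<in> relation_group"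
    using relation_group_add_right by (simp only: diff_diff_eq)
  then show "tensor_class (frag_of (x, y \<oplus>\<^bsub>S\<^esub> y')) = tensor_class (frag_of (x, y)) \<otimes>\<^bsub>pair_group Mod relation_group\<^esub> tensor_class (frag_of (x, y'))"
    using c by (subst tensor_class_add[symmetric]; (intro tensor_class_eqI pair_group_closed)?) simp_all
next
  fix x b y assume c: "x \<in> carrier S" "b \<in> carrier R" "y \<in> carrier S"
  then have "frag_of (x \<otimes>\<^bsub>S\<^esub> h b, y) - frag_of (x, h b \<otimes>\<^bsub>S\<^esub> y) \<in> relation_group"
    by (rule relation_group_middle)
  then show "tensor_class (frag_of (x \<otimes>\<^bsub>S\<^esub> h b, y)) = tensor_class (frag_of (x, h b \<otimes>\<^bsub>S\<^esub> y))"
    using c by (intro tensor_class_eqI) auto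
qed

lemma act_left_frag_of [simp]: "act_left a (frag_of (x, y)) = frag_of (a \<otimes>\<^bsub>S\<^esub> x, y)"
  by (simp add: act_left_def frag_extend_of)
lemma act_right_frag_of [simp]: "act_right a (frag_of (x, y)) = frag_of (x, y \<otimes>\<^bsub>S\<^esub> a)"
  by (simp add: act_right_def frag_extend_of)

lemma act_left_hom: assumes "a \<in> carrier S" shows "act_left a \<in> hom pair_group pair_group"
proof (rule homI)
  fix z assume "z \<in> carrier pair_group"
  then have "Poly_Mapping.keys z \<subseteq> carrier S \<times> carrier S" by simp
  moreover have "Poly_Mapping.keys (act_left a z) \<subseteq> (\<Union>p\<in>Poly_Mapping.keys z. {(a \<otimes>\<^bsub>S\<^esub> fst p, snd p)})"
    unfolding act_left_def by (rule order_trans[OF keys_frag_extend]) auto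
  ultimately show "act_left a z \<in> carrier pair_group" using assms by fastforce
qed (simp add: act_left_def frag_extend_add)

lemma act_right_hom: assumes "a \<in> carrier S" shows "act_right a \<in> hom pair_group pair_group"
proof (rule homI)
  fix z assume "z \<in> carrier pair_group"
  then have "Poly_Mapping.keys z \<subseteq> carrier S \<times> carrier S" by simp
  moreover have "Poly_Mapping.keys (act_right a z) \<subseteq> (\<Union>p\<in>Poly_Mapping.keys z. {(fst p, snd p \<otimes>\<^bsub>S\<^esub> a)})"
    unfolding act_right_def by (rule order_trans[OF keys_frag_extend]) auto
  ultimately show "act_right a z \<in> carrier pair_group" using assms by fastforce
qed (simp add: act_right_def frag_extend_add)

lemma tensor_square_simps:
  "carrier tensor_square = carrier (pair_group Mod relation_group)" "monoid.mult tensor_square = monoid.mult (pair_group Mod relation_group)"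
  by (simp_all add: tensor_product_def Let_def tensor_kernel_def)

lemma carrier_tensor_square: "carrier tensor_square = tensor_class ` carrier pair_group"
  by (simp add: tensor_square_simps carrier_FactGroup)

lemma lact_tensor_class:
  assumes "a \<in> carrier S" "z \<in> carrier pair_group"
  shows "lact tensor_square a (tensor_class z) = tensor_class (act_left a z)"
proof -
  have hom: "(\<lambda>z. tensor_class (act_left a z)) \<in> hom pair_group (pair_group Mod relation_group)"
    using Group.hom_compose[OF act_left_hom[OF assms(1)] tensor_class_hom] by (simp add: comp_def)
  have bal: "balanced (pair_group Mod relation_group) (\<lambda>p. tensor_class (act_left a (frag_of p)))"
    unfolding balanced_def
  proof (intro conjI ballI)
    show "(\<lambda>p. tensor_class (act_left a (frag_of p))) \<in> carrier S \<times> carrier S \<rightarrow> carrier (pair_group Mod relation_group)"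
      using hom_in_carrier[OF hom] by auto
  qed (use balanced_tensor_class assms in \<open>auto simp: balanced_def S.r_distr S.m_assoc[symmetric]\<close>)
  have "lact tensor_square a (tensor_class z) = the_elem ((\<lambda>z. tensor_class (act_left a z)) ` tensor_class z)"
    by (simp add: tensor_product_def Let_def tensor_kernel_def act_left_def)
  then show ?thesis using the_elem_balanced_image[OF _ hom bal assms(2)] group_Mod comm_group.axioms(2) by fastforce
qed

lemma ract_tensor_class:
  assumes "a \<in> carrier S" "z \<in> carrier pair_group"
  shows "ract tensor_square (tensor_class z) a = tensor_class (act_right a z)"
proof -
  have hom: "(\<lambda>z. tensor_class (act_right a z)) \<in> hom pair_group (pair_group Mod relation_group)"
    using Group.hom_compose[OF act_right_hom[OF assms(1)] tensor_class_hom] by (simp add: comp_def)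
  have bal: "balanced (pair_group Mod relation_group) (\<lambda>p. tensor_class (act_right a (frag_of p)))"
    unfolding balanced_def
  proof (intro conjI ballI)
    show "(\<lambda>p. tensor_class (act_right a (frag_of p))) \<in> carrier S \<times> carrier S \<rightarrow> carrier (pair_group Mod relation_group)"
      using hom_in_carrier[OF hom] by auto
  qed (use balanced_tensor_class assms in \<open>auto simp: balanced_def S.l_distr S.m_assoc\<close>)
  have "ract tensor_square (tensor_class z) a = the_elem ((\<lambda>z. tensor_class (act_right a z)) ` tensor_class z)"
    by (simp add: tensor_product_def Let_def tensor_kernel_def act_right_def)
  then show ?thesis using the_elem_balanced_image[OF _ hom bal assms(2)] group_Mod comm_group.axioms(2) by fastforce
qed

abbreviation "mu \<equiv> lift (add_monoid S) (\<lambda>p. fst p \<otimes>\<^bsub>S\<^esub> snd p)"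

lemma balanced_mult: "balanced (add_monoid S) (\<lambda>p. fst p \<otimes>\<^bsub>S\<^esub> snd p)"
  unfolding balanced_def by (auto simp: S.l_distr S.r_distr S.m_assoc)

lemma mu_hom: "mu \<in> hom pair_group (add_monoid S)"
  by (rule lift_hom[OF S.a_comm_group]) auto

lemma mu_frag_of: "x \<in> carrier S \<Longrightarrow> y \<in> carrier S \<Longrightarrow> mu (frag_of (x, y)) = x \<otimes>\<^bsub>S\<^esub> y"
  by (subst lift_frag_of[OF S.a_comm_group]) auto

lemma multiplication_map_tensor_class:
  assumes "z \<in> carrier pair_group"
  shows "multiplication_map S (tensor_class z) = mu z"
proof -
  have "(\<lambda>z. \<Oplus>\<^bsub>S\<^esub>p\<in>Poly_Mapping.keys z.
            [Poly_Mapping.lookup z p] \<cdot>\<^bsub>S\<^esub> (fst p \<otimes>\<^bsub>S\<^esub> snd p)) = mu"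
    by (simp add: lift_def finsum_def add_pow_def fun_eq_iff)
  then have "multiplication_map S (tensor_class z) = the_elem (mu ` tensor_class z)"
    unfolding multiplication_map_def by (rule arg_cong)
  also have "\<dots> = mu z"
    by (rule the_elem_balanced_image[OF _ mu_hom balanced_lift[OF S.a_comm_group balanced_mult] assms])
      (simp add: S.a_comm_group comm_group.axioms(2))
  finally show ?thesis .
qed

lemma mu_act:
  assumes a: "a \<in> carrier S" and z: "z \<in> carrier pair_group"
  shows "mu (act_left a z) = a \<otimes>\<^bsub>S\<^esub> mu z" "mu (act_right a z) = mu z \<otimes>\<^bsub>S\<^esub> a"
proof -
  note G = comm_group.axioms(2)[OF S.a_comm_group]
  have c: "mu z \<in> carrier S" if "z \<in> carrier pair_group" for z using hom_in_carrier[OF mu_hom that] by simp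
  have l: "(\<lambda>x. a \<otimes>\<^bsub>S\<^esub> mu x) \<in> hom pair_group (add_monoid S)"
    using a c Group.hom_mult[OF mu_hom] by (intro homI) (auto simp: S.r_distr)
  have r: "(\<lambda>x. mu x \<otimes>\<^bsub>S\<^esub> a) \<in> hom pair_group (add_monoid S)"
    using a c Group.hom_mult[OF mu_hom] by (intro homI) (auto simp: S.l_distr)
  show "mu (act_left a z) = a \<otimes>\<^bsub>S\<^esub> mu z"
    by (rule hom_eq_on_generators[OF G _ l _ z, where f = "\<lambda>z. mu (act_left a z)"])
      (use Group.hom_compose[OF act_left_hom[OF a] mu_hom] a in \<open>auto simp: comp_def mu_frag_of S.m_assoc\<close>)
  show "mu (act_right a z) = mu z \<otimes>\<^bsub>S\<^esub> a"
    by (rule hom_eq_on_generators[OF G _ r _ z, where f = "\<lambda>z. mu (act_right a z)"])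
      (use Group.hom_compose[OF act_right_hom[OF a] mu_hom] a in \<open>auto simp: comp_def mu_frag_of S.m_assoc\<close>)
qed

lemma multiplication_map_bimodule_hom:
  "multiplication_map S \<in> bimodule_hom S S tensor_square (restricted_bimodule S (\<lambda>a. a) (\<lambda>a. a))"
proof -
  have c: "mu z \<in> carrier S" if "z \<in> carrier pair_group" for z using hom_in_carrier[OF mu_hom that] by simp
  have ac: "act_left a z \<in> carrier pair_group" "act_right a z \<in> carrier pair_group" if "a \<in> carrier S" "z \<in> carrier pair_group" for a z
    using that hom_in_carrier[OF act_left_hom] hom_in_carrier[OF act_right_hom] by blast+
  have pc: "z + w \<in> carrier pair_group" if "z \<in> carrier pair_group" "w \<in> carrier pair_group" for z w :: "'c \<times> 'c \<Rightarrow>\<^sub>0 int"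
    using that keys_add[of z w] by auto
  have pl: "mu (z + w) = mu z \<oplus>\<^bsub>S\<^esub> mu w" if "z \<in> carrier pair_group" "w \<in> carrier pair_group" for z w
    using Group.hom_mult[OF mu_hom that] by simp
  show ?thesis unfolding bimodule_hom_def right_hom_def hom_def carrier_tensor_square
    by (auto simp del: carrier_free_Abelian_group_iff simp: tensor_square_simps(2) multiplication_map_tensor_class
       c ac pc pl mu_act lact_tensor_class ract_tensor_class tensor_class_add[symmetric] simp del: mult_FactGroup)
qed

lemma mu_sum:
  assumes "finite I" "x \<in> I \<rightarrow> carrier S" "y \<in> I \<rightarrow> carrier S"
  shows "mu (\<Sum>i\<in>I. frag_of (x i, y i)) = (\<Oplus>\<^bsub>S\<^esub>i\<in>I. x i \<otimes>\<^bsub>S\<^esub> y i)"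
  using assms
proof (induct rule: finite_induct)
  case empty
  show ?case by (simp add: lift_def finsum_def comm_monoid.finprod_empty[OF S.a_comm_monoid])
next
  case (insert k I)
  have 1: "frag_of (x k, y k) \<in> carrier pair_group" using insert by auto
  have 2: "(\<Sum>i\<in>I. frag_of (x i, y i)) \<in> carrier pair_group"
    by (rule sum_closed_free_Abelian_group) (use insert in auto)
  have "mu (frag_of (x k, y k) + (\<Sum>i\<in>I. frag_of (x i, y i))) = mu (frag_of (x k, y k)) \<oplus>\<^bsub>S\<^esub> mu (\<Sum>i\<in>I. frag_of (x i, y i))"
    using Group.hom_mult[OF mu_hom 1 2] by simp
  then show ?case using insert by (simp add: mu_frag_of S.finsum_insert Pi_iff)
qed

text \<open>Separability is the existence of an element \<open>e\<close> with \<open>a e = e a\<close> and multiplication image 1: such an \<open>e\<close> gives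
the section \<open>a \<mapsto> a e\<close>, and every section \<open>s\<close> arises from \<open>e = s 1\<close>.\<close>

lemma separable_extensionI:
  assumes e: "e \<in> carrier pair_group" and one: "mu e = \<one>\<^bsub>S\<^esub>"
    and cas: "\<And>a. a \<in> carrier S \<Longrightarrow> tensor_class (act_left a e) = tensor_class (act_right a e)"
  shows "separable_extension R S h"
proof -
  have ac: "act_left a z \<in> carrier pair_group" "act_right a z \<in> carrier pair_group" if "a \<in> carrier S" "z \<in> carrier pair_group" for a z
    using that hom_in_carrier[OF act_left_hom] hom_in_carrier[OF act_right_hom] by blast+
  let ?s = "\<lambda>a. tensor_class (act_left a e)"
  note G = comm_group.axioms(2)[OF group_Mod]
  note PG = comm_group.axioms(2)[OF abelian_free_Abelian_group]
  have add: "?s (a \<oplus>\<^bsub>S\<^esub> b) = ?s a \<otimes>\<^bsub>pair_group Mod relation_group\<^esub> ?s b" if ab: "a \<in> carrier S" "b \<in> carrier S" for a b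
  proof (rule hom_eq_on_generators[OF G _ _ _ e])
    show "(\<lambda>z. tensor_class (act_left (a \<oplus>\<^bsub>S\<^esub> b) z)) \<in> hom pair_group (pair_group Mod relation_group)"
      using Group.hom_compose[OF act_left_hom tensor_class_hom] ab by (simp add: comp_def)
    show "(\<lambda>z. tensor_class (act_left a z) \<otimes>\<^bsub>pair_group Mod relation_group\<^esub> tensor_class (act_left b z)) \<in> hom pair_group (pair_group Mod relation_group)"
      by (rule comm_group.hom_group_mult[OF group_Mod])
        (use ab Group.hom_compose[OF act_left_hom tensor_class_hom] in \<open>simp_all add: comp_def\<close>)
    show "tensor_class (act_left (a \<oplus>\<^bsub>S\<^esub> b) (frag_of (x, y))) =
      tensor_class (act_left a (frag_of (x, y))) \<otimes>\<^bsub>pair_group Mod relation_group\<^esub> tensor_class (act_left b (frag_of (x, y)))"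
      if "x \<in> carrier S" "y \<in> carrier S" for x y
      using balanced_tensor_class ab that by (auto simp: balanced_def S.l_distr)
  qed
  have ll: "act_left (b \<otimes>\<^bsub>S\<^esub> a) e = act_left b (act_left a e)" if ab: "a \<in> carrier S" "b \<in> carrier S" for a b
    by (rule hom_eq_on_generators[OF PG _ _ _ e])
      (use ab act_left_hom Group.hom_compose[OF act_left_hom act_left_hom] in \<open>auto simp: comp_def S.m_assoc\<close>)
  have lr: "act_left b (act_right a e) = act_right a (act_left b e)" if ab: "a \<in> carrier S" "b \<in> carrier S" for a b
    by (rule hom_eq_on_generators[OF PG _ _ _ e])
      (use ab act_left_hom Group.hom_compose[OF act_left_hom act_right_hom] 
       Group.hom_compose[OF act_right_hom act_left_hom] in \<open>auto simp: comp_def S.m_assoc\<close>)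
  have left: "?s (b \<otimes>\<^bsub>S\<^esub> a) = lact tensor_square b (?s a)" if ab: "a \<in> carrier S" "b \<in> carrier S" for a b
    using ab e ac ll by (simp add: lact_tensor_class del: carrier_free_Abelian_group_iff)
  have right: "?s (b \<otimes>\<^bsub>S\<^esub> a) = ract tensor_square (?s b) a" if ab: "a \<in> carrier S" "b \<in> carrier S" for a b
  proof -
    have "?s (b \<otimes>\<^bsub>S\<^esub> a) = lact tensor_square b (tensor_class (act_left a e))"
      using left ab by simp
    also have "\<dots> = lact tensor_square b (tensor_class (act_right a e))"
      using cas ab by simp
    also have "\<dots> = tensor_class (act_left b (act_right a e))"
      using ab e ac by (simp add: lact_tensor_class del: carrier_free_Abelian_group_iff)
    also have "\<dots> = ract tensor_square (?s b) a"
      using ab e ac lr by (simp add: ract_tensor_class del: carrier_free_Abelian_group_iff)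
    finally show ?thesis .
  qed
  have "?s \<in> bimodule_hom S S (restricted_bimodule S (\<lambda>a. a) (\<lambda>a. a)) tensor_square"
    unfolding bimodule_hom_def right_hom_def hom_def carrier_tensor_square
    using add left right ac e
    by (auto simp: tensor_square_simps(2) simp del: carrier_free_Abelian_group_iff mult_FactGroup)
  moreover have "\<forall>a\<in>carrier (restricted_bimodule S (\<lambda>a. a) (\<lambda>a. a)). multiplication_map S (?s a) = a"
    using ac e one mu_act by (simp add: multiplication_map_tensor_class del: carrier_free_Abelian_group_iff)
  ultimately show ?thesis
    unfolding separable_extension_def split_epimorphism_def
    using multiplication_map_bimodule_hom ring_hom_ring_axioms
    by (auto)
qed

lemma separable_extensionE:
  assumes "separable_extension R S h"
  obtains e where "e \<in> carrier pair_group" "mu e = \<one>\<^bsub>S\<^esub>"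
    "\<And>a. a \<in> carrier S \<Longrightarrow> tensor_class (act_left a e) = tensor_class (act_right a e)"
proof -
  from assms obtain s where s: "s \<in> bimodule_hom S S (restricted_bimodule S (\<lambda>a. a) (\<lambda>a. a)) tensor_square"
    and sec: "\<And>y. y \<in> carrier S \<Longrightarrow> multiplication_map S (s y) = y"
    by (auto simp: separable_extension_def split_epimorphism_def)
  have sc: "s a \<in> carrier tensor_square" if "a \<in> carrier S" for a
    using s that by (auto simp: bimodule_hom_def right_hom_def hom_def)
  then obtain e where e: "e \<in> carrier pair_group" "s \<one>\<^bsub>S\<^esub> = tensor_class e"
    unfolding carrier_tensor_square by blast
  have "s (a \<otimes>\<^bsub>S\<^esub> \<one>\<^bsub>S\<^esub>) = lact tensor_square a (s \<one>\<^bsub>S\<^esub>)" "s (\<one>\<^bsub>S\<^esub> \<otimes>\<^bsub>S\<^esub> a) = ract tensor_square (s \<one>\<^bsub>S\<^esub>) a"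
    if "a \<in> carrier S" for a
    using s that S.one_closed unfolding bimodule_hom_def right_hom_def mem_Collect_eq restricted_bimodule_simps by blast+
  then have "tensor_class (act_left a e) = tensor_class (act_right a e)" if "a \<in> carrier S" for a
    using that e by (simp add: lact_tensor_class ract_tensor_class del: carrier_free_Abelian_group_iff)
  moreover have "mu e = \<one>\<^bsub>S\<^esub>" using sec[of "\<one>\<^bsub>S\<^esub>"] e by (simp add: multiplication_map_tensor_class del: carrier_free_Abelian_group_iff)
  ultimately show thesis using e that by blast
qed

end

section \<open>Matrices over a noncommutative ring\<close>

lemma index_mult_mat_sum:
  assumes "A \<in> carrier_mat n m" "B \<in> carrier_mat m l" "i < n" "j < l"
  shows "(A * B) $$ (i, j) = (\<Sum>k<m. A $$ (i, k) * B $$ (k, j))"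
  using assms by (auto simp: scalar_prod_def lessThan_atLeast0 intro!: sum.cong)

lemma ring_ring_mat: "ring (ring_mat TYPE('a :: ring_1) n b)"
  by (unfold_locales, insert add_inv_exists_mat, auto simp: ring_mat_def algebra_simps Units_def)

lemma scalar_matrix_carrier [simp]: "scalar_matrix n r \<in> carrier_mat n n"
  by (simp add: scalar_matrix_def)

lemma scalar_matrix_mult:
  fixes a :: "'r :: ring_1 mat"
  assumes "a \<in> carrier_mat n n" "i < n" "j < n"
  shows "(scalar_matrix n r * a) $$ (i, j) = r * a $$ (i, j)"
    and "(a * scalar_matrix n r) $$ (i, j) = a $$ (i, j) * r"
proof -
  have e: "scalar_matrix n r $$ (i, j) = (if i = j then r else 0)" if "i < n" "j < n" for i j
    using that by (simp add: scalar_matrix_def)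
  have "(scalar_matrix n r * a) $$ (i, j) = (\<Sum>k<n. if k = i then r * a $$ (i, j) else 0)"
    unfolding index_mult_mat_sum[OF scalar_matrix_carrier assms] using assms e by (intro sum.cong) auto
  then show "(scalar_matrix n r * a) $$ (i, j) = r * a $$ (i, j)" using assms by simp
  have "(a * scalar_matrix n r) $$ (i, j) = (\<Sum>k<n. if k = j then a $$ (i, j) * r else 0)"
    unfolding index_mult_mat_sum[OF assms(1) scalar_matrix_carrier assms(2,3)] using assms e by (intro sum.cong) auto
  then show "(a * scalar_matrix n r) $$ (i, j) = a $$ (i, j) * r" using assms by simp
qed

lemma scalar_matrix_one: "scalar_matrix n 1 = 1\<^sub>m n"
  by (rule eq_matI) (auto simp: scalar_matrix_def)

lemma scalar_matrix_add: "scalar_matrix n (r + s) = scalar_matrix n r + scalar_matrix n s"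
  by (rule eq_matI) (auto simp: scalar_matrix_def)

lemma scalar_matrix_times: "scalar_matrix n (r * s) = scalar_matrix n r * scalar_matrix n s"
proof (rule eq_matI)
  fix i j assume "i < dim_row (scalar_matrix n r * scalar_matrix n s)" "j < dim_col (scalar_matrix n r * scalar_matrix n s)"
  then have "i < n" "j < n" by (auto simp: scalar_matrix_def)
  then show "scalar_matrix n (r * s) $$ (i, j) = (scalar_matrix n r * scalar_matrix n s) $$ (i, j)"
    by (simp add: scalar_matrix_mult) (simp add: scalar_matrix_def)
qed (auto simp: scalar_matrix_def)

definition unit_mat :: "nat \<Rightarrow> nat \<Rightarrow> nat \<Rightarrow> 'r :: ring_1 mat" where
  "unit_mat n i j = mat n n (\<lambda>(r, s). if r = i \<and> s = j then 1 else 0)"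

lemma unit_mat_carrier [simp]: "unit_mat n i j \<in> carrier_mat n n"
  by (simp add: unit_mat_def)

lemma unit_mat_index: "r < n \<Longrightarrow> s < n \<Longrightarrow> unit_mat n i j $$ (r, s) = (if r = i \<and> s = j then 1 else 0)"
  by (simp add: unit_mat_def)

lemma unit_mat_mult:
  assumes "a \<in> carrier_mat n n" "i < n" "j < n" "r < n" "s < n"
  shows "(unit_mat n i j * a) $$ (r, s) = (if r = i then a $$ (j, s) else 0)"
    and "(a * unit_mat n i j) $$ (r, s) = (if s = j then a $$ (r, i) else 0)"
proof -
  have "(unit_mat n i j * a) $$ (r, s) = (\<Sum>k<n. if k = j then (if r = i then a $$ (j, s) else 0) else 0)"
    unfolding index_mult_mat_sum[OF unit_mat_carrier assms(1,4,5)] using assms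
    by (intro sum.cong) (auto simp: unit_mat_index)
  then show "(unit_mat n i j * a) $$ (r, s) = (if r = i then a $$ (j, s) else 0)" using assms by simp
  have "(a * unit_mat n i j) $$ (r, s) = (\<Sum>k<n. if k = i then (if s = j then a $$ (r, i) else 0) else 0)"
    unfolding index_mult_mat_sum[OF assms(1) unit_mat_carrier assms(4,5)] using assms
    by (intro sum.cong) (auto simp: unit_mat_index)
  then show "(a * unit_mat n i j) $$ (r, s) = (if s = j then a $$ (r, i) else 0)" using assms by simp
qed

lemma centralizer_algebra_simps:
  "carrier (centralizer_algebra n c) = {a \<in> carrier_mat n n. a * c = c * a}"
  "x \<otimes>\<^bsub>centralizer_algebra n c\<^esub> y = x * y"
  "x \<oplus>\<^bsub>centralizer_algebra n c\<^esub> y = x + y"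
  "\<one>\<^bsub>centralizer_algebra n c\<^esub> = 1\<^sub>m n"
  "\<zero>\<^bsub>centralizer_algebra n c\<^esub> = 0\<^sub>m n n"
  by (simp_all add: centralizer_algebra_def ring_mat_simps)

lemma ring_centralizer_algebra:
  fixes c :: "'r :: ring_1 mat"
  assumes c: "c \<in> carrier_mat n n"
  shows "ring (centralizer_algebra n c)"
proof -
  interpret M: ring "ring_mat TYPE('r) n ()" by (rule ring_ring_mat)
  let ?C = "{a \<in> carrier_mat n n. a * c = c * a}"
  have "subring ?C (ring_mat TYPE('r) n ())"
  proof (rule M.subringI)
    show "?C \<subseteq> carrier (ring_mat TYPE('r) n ())" by (auto simp: ring_mat_simps)
    show "\<one>\<^bsub>ring_mat TYPE('r) n ()\<^esub> \<in> ?C" using c by (simp add: ring_mat_simps)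
  next
    fix a assume a: "a \<in> ?C"
    have "a \<in> carrier (ring_mat TYPE('r) n ())" "c \<in> carrier (ring_mat TYPE('r) n ())"
      using a c by (auto simp: ring_mat_simps)
    then have "\<ominus>\<^bsub>ring_mat TYPE('r) n ()\<^esub> a \<in> carrier (ring_mat TYPE('r) n ())"
      "\<ominus>\<^bsub>ring_mat TYPE('r) n ()\<^esub> a \<otimes>\<^bsub>ring_mat TYPE('r) n ()\<^esub> c = c \<otimes>\<^bsub>ring_mat TYPE('r) n ()\<^esub> \<ominus>\<^bsub>ring_mat TYPE('r) n ()\<^esub> a"
      using a by (simp_all add: M.l_minus M.r_minus) (simp add: ring_mat_simps)
    then show "\<ominus>\<^bsub>ring_mat TYPE('r) n ()\<^esub> a \<in> ?C" by (simp add: ring_mat_simps)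
  next
    fix a b assume ab: "a \<in> ?C" "b \<in> ?C"
    then have "a * b * c = a * (b * c)" using c by (intro assoc_mult_mat[of _ n n _ n _ n]) auto
    also have "\<dots> = a * c * b"
      using ab c assoc_mult_mat[of a n n c n b n] by auto
    also have "\<dots> = c * (a * b)"
      using ab c assoc_mult_mat[of c n n a n b n] by auto
    finally have "a * b * c = c * (a * b)" .
    moreover have "a * b \<in> carrier_mat n n" using ab by (intro mult_carrier_mat[of _ n n]) auto
    ultimately show "a \<otimes>\<^bsub>ring_mat TYPE('r) n ()\<^esub> b \<in> ?C" by (simp add: ring_mat_simps)
    show "a \<oplus>\<^bsub>ring_mat TYPE('r) n ()\<^esub> b \<in> ?C" using ab c add_mult_distrib_mat[of a n n b c n] mult_add_distrib_mat[of c n n a n b]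
      by (auto simp: ring_mat_simps)
  qed
  then show ?thesis unfolding centralizer_algebra_def by (rule M.subring_is_ring)
qed

section \<open>The centralizer of a Jordan matrix\<close>

text \<open>The blocks are indexed by flat row numbers: \<open>ps i\<close> is the position of row \<open>i\<close> inside its
  block, counted from 0, \<open>sz i\<close> the size of that block and \<open>ev i\<close> its eigenvalue, as an element of \<open>R\<close>. So
  the block of \<open>i\<close> starts at row \<open>i - ps i\<close>, and all its data can be recovered from any of its rows.\<close>

locale jordan_layout =
  fixes n :: nat and ps sz :: "nat \<Rightarrow> nat" and ev :: "nat \<Rightarrow> 'r :: ring_1" and c :: "'r mat"
  assumes block: "\<And>i. i < n \<Longrightarrow> ps i \<le> i \<and> ps i < sz i \<and> i - ps i + sz i \<le> n"
    and same_block: "\<And>i k. i < n \<Longrightarrow> k < sz i \<Longrightarrow>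
      ps (i - ps i + k) = k \<and> sz (i - ps i + k) = sz i \<and> ev (i - ps i + k) = ev i"
    and c_eq: "c = mat n n (\<lambda>(i, j). if i = j then ev i else if j = Suc i \<and> Suc (ps i) < sz i then 1 else 0)"
    and ev_central: "\<And>i x. i < n \<Longrightarrow> ev i * x = x * ev i"
    and ev_regular: "\<And>i j x. i < n \<Longrightarrow> j < n \<Longrightarrow> ev i \<noteq> ev j \<Longrightarrow> (ev i - ev j) * x = 0 \<Longrightarrow> x = 0"
begin

abbreviation "A \<equiv> centralizer_algebra n c"

lemma carrier_A_mat: "a \<in> carrier A \<Longrightarrow> a \<in> carrier_mat n n"
  by (simp add: centralizer_algebra_simps)

lemma succ_index:
  assumes "i < n" "Suc (ps i) < sz i"
  shows "Suc i < n" "ps (Suc i) = Suc (ps i)" "sz (Suc i) = sz i" "ev (Suc i) = ev i"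
  using block[OF assms(1)] same_block[OF assms] assms(2) by auto

lemma pred_index:
  assumes "i < n" "0 < ps i"
  shows "i - 1 < n" "Suc (i - 1) = i" "Suc (ps (i - 1)) = ps i" "sz (i - 1) = sz i" "ev (i - 1) = ev i"
    "Suc (ps (i - 1)) < sz (i - 1)"
proof -
  obtain k where k: "ps i = Suc k" using assms(2) by (cases "ps i") auto
  have b: "Suc k \<le> i" "Suc k < sz i" using block[OF assms(1)] k by auto
  then have "i - ps i + k = i - 1" using k by simp
  then have "ps (i - 1) = k" "sz (i - 1) = sz i" "ev (i - 1) = ev i"
    using same_block[OF assms(1), of k] b by auto
  then show "i - 1 < n" "Suc (i - 1) = i" "Suc (ps (i - 1)) = ps i" "sz (i - 1) = sz i" "ev (i - 1) = ev i"
    "Suc (ps (i - 1)) < sz (i - 1)"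
    using assms(1) b k by auto
qed

lemma head_index:
  assumes "i < n"
  shows "i - ps i < n" "ps (i - ps i) = 0" "sz (i - ps i) = sz i" "ev (i - ps i) = ev i"
  using block[OF assms] same_block[of i 0] assms by auto

lemma block_index:
  assumes "i < n" "ps i = 0" "k < sz i"
  shows "i + k < n" "ps (i + k) = k" "sz (i + k) = sz i" "ev (i + k) = ev i"
  using block[OF assms(1)] same_block[OF assms(1,3)] assms by auto

lemma c_carrier: "c \<in> carrier_mat n n" by (simp add: c_eq)

lemma c_index:
  assumes "k < n" "j < n"
  shows "c $$ (k, j) = (if k = j then ev j else 0) + (if 0 < ps j \<and> k = j - 1 then 1 else 0)"
proof -
  have "j = Suc k \<and> Suc (ps k) < sz k \<longleftrightarrow> 0 < ps j \<and> k = j - 1"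
  proof
    assume "j = Suc k \<and> Suc (ps k) < sz k"
    then show "0 < ps j \<and> k = j - 1" using succ_index(2)[OF assms(1)] by simp
  next
    assume "0 < ps j \<and> k = j - 1"
    then show "j = Suc k \<and> Suc (ps k) < sz k"
      using pred_index(2,6)[OF assms(2)] by simp
  qed
  moreover have "c $$ (k, j) = (if k = j then ev j else 0) + (if j = Suc k \<and> Suc (ps k) < sz k then 1 else 0)"
    using assms by (simp add: c_eq)
  ultimately show ?thesis by (simp only:)
qed

lemma mult_c_index:
  assumes a: "a \<in> carrier_mat n n" and ij: "i < n" "j < n"
  shows "(a * c) $$ (i, j) = a $$ (i, j) * ev j + (if ps j = 0 then 0 else a $$ (i, j - 1))"
    and "(c * a) $$ (i, j) = ev i * a $$ (i, j) + (if Suc (ps i) < sz i then a $$ (Suc i, j) else 0)"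
proof -
  have "(a * c) $$ (i, j) = (\<Sum>k<n. (if k = j then a $$ (i, j) * ev j else 0) + 
      (if k = j - 1 then if ps j = 0 then 0 else a $$ (i, j - 1) else 0))"
    unfolding index_mult_mat_sum[OF a c_carrier ij]
  proof (rule sum.cong[OF refl])
    fix k assume "k \<in> {..<n}"
    then have k: "k < n" by simp
    show "a $$ (i, k) * c $$ (k, j) = (if k = j then a $$ (i, j) * ev j else 0) +
      (if k = j - 1 then if ps j = 0 then 0 else a $$ (i, j - 1) else 0)"
      unfolding c_index[OF k ij(2)] by (simp add: distrib_left)
  qed
  also have "\<dots> = a $$ (i, j) * ev j + (if ps j = 0 then 0 else a $$ (i, j - 1))"
    using ij by (auto simp: sum.distrib)
  finally show "(a * c) $$ (i, j) = a $$ (i, j) * ev j + (if ps j = 0 then 0 else a $$ (i, j - 1))" .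
  have "(c * a) $$ (i, j) = (\<Sum>k<n. (if k = i then ev i * a $$ (i, j) else 0) + 
      (if k = Suc i then if Suc (ps i) < sz i then a $$ (Suc i, j) else 0 else 0))"
    unfolding index_mult_mat_sum[OF c_carrier a ij]
    using ij by (intro sum.cong) (auto simp: c_eq)
  also have "\<dots> = ev i * a $$ (i, j) + (if Suc (ps i) < sz i then a $$ (Suc i, j) else 0)"
    using ij succ_index[of i] by (simp add: sum.distrib)
  finally show "(c * a) $$ (i, j) = ev i * a $$ (i, j) + (if Suc (ps i) < sz i then a $$ (Suc i, j) else 0)" .
qed

text \<open>The entry times the difference of the eigenvalues is a difference of two neighbouring entries: one to
the left in the same block column, one below in the same block row. Both vanish by induction towards the
bottom left corner of the block.\<close>

lemma carrier_A_off_eigenvalue: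
  assumes "a \<in> carrier A" "i < n" "j < n" "ev i \<noteq> ev j"
  shows "a $$ (i, j) = 0"
  using assms(2-)
proof (induct "ps j + (sz i - ps i)" arbitrary: i j rule: less_induct)
  case less
  have a: "a \<in> carrier_mat n n" "a * c = c * a" using assms(1) by (auto simp: centralizer_algebra_simps)
  have "(if ps j = 0 then 0 else a $$ (i, j - 1)) = 0"
    using less(1)[of "j - 1" i] pred_index[of j] less by auto
  moreover have "(if Suc (ps i) < sz i then a $$ (Suc i, j) else 0) = 0"
    using less(1)[of j "Suc i"] succ_index[of i] less by auto
  ultimately have "a $$ (i, j) * ev j = ev i * a $$ (i, j)"
    using mult_c_index[OF a(1) less(2,3)] a(2) by simp
  then have "(ev i - ev j) * a $$ (i, j) = 0"
    using ev_central[OF less(3)] by (simp add: left_diff_distrib)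
  then show ?case using ev_regular less by blast
qed

text \<open>Once the entries between distinct eigenvalues vanish, the central eigenvalues cancel from \<open>a c = c a\<close> and
only commutation with the nilpotent part remains: shifting columns to the right equals shifting rows up.\<close>

lemma mem_carrier_A_iff:
  "a \<in> carrier A \<longleftrightarrow> a \<in> carrier_mat n n \<and>
     (\<forall>i<n. \<forall>j<n. ev i \<noteq> ev j \<longrightarrow> a $$ (i, j) = 0) \<and>
     (\<forall>i<n. \<forall>j<n. (if ps j = 0 then 0 else a $$ (i, j - 1)) = (if Suc (ps i) < sz i then a $$ (Suc i, j) else 0))"
  (is "?l \<longleftrightarrow> ?m \<and> ?o \<and> ?s")
proof
  assume l: ?l
  then have a: "a \<in> carrier_mat n n" "a * c = c * a" by (auto simp: centralizer_algebra_simps)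
  have o: ?o using carrier_A_off_eigenvalue[OF l] by blast
  have "(if ps j = 0 then 0 else a $$ (i, j - 1)) = (if Suc (ps i) < sz i then a $$ (Suc i, j) else 0)"
    if ij: "i < n" "j < n" for i j
  proof -
    have "a $$ (i, j) * ev j = ev i * a $$ (i, j)"
      using o ij ev_central by (cases "ev i = ev j") auto
    then show ?thesis using mult_c_index[OF a(1) ij] a(2) by simp
  qed
  with o a show "?m \<and> ?o \<and> ?s" by blast
next
  assume r: "?m \<and> ?o \<and> ?s"
  then have m: ?m by blast
  have "a * c = c * a"
  proof (rule eq_matI)
    fix i j assume "i < dim_row (c * a)" "j < dim_col (c * a)"
    then have ij: "i < n" "j < n" using m c_carrier by auto
    have "a $$ (i, j) * ev j = ev i * a $$ (i, j)"
      using r ij ev_central by (cases "ev i = ev j") auto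
    then show "(a * c) $$ (i, j) = (c * a) $$ (i, j)" using r ij mult_c_index[OF m ij] by simp
  qed (use m c_carrier in auto)
  with m show ?l by (simp add: centralizer_algebra_simps)
qed

lemma carrier_A_shift:
  assumes "a \<in> carrier A" "i < n" "j < n"
  shows "(if ps j = 0 then 0 else a $$ (i, j - 1)) = (if Suc (ps i) < sz i then a $$ (Suc i, j) else 0)"
  using assms mem_carrier_A_iff by blast

text \<open>Going up the diagonal from an entry ends in the first row of the block, unless the entry lies below the main
diagonal: then the first column comes first, and an entry of that column below the first row vanishes.\<close>

lemma toeplitz_entry:
  assumes a: "a \<in> carrier A" and "i < n" "j < n"
  shows "a $$ (i, j) = (if ps i \<le> ps j then a $$ (i - ps i, j - ps i) else 0)"
  using assms(2-)
proof (induct "ps i" arbitrary: i j)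
  case 0 then show ?case by simp
next
  case (Suc p)
  have p: "0 < ps i" using Suc by simp
  note pi = pred_index[OF Suc(3) p]
  have "a $$ (i, j) = (if ps j = 0 then 0 else a $$ (i - 1, j - 1))"
    using carrier_A_shift[OF a pi(1) Suc(4)] pi by simp
  also have "\<dots> = (if ps i \<le> ps j then a $$ (i - ps i, j - ps i) else 0)"
  proof (cases "ps j = 0")
    case True then show ?thesis using p by simp
  next
    case False
    then have pj: "0 < ps j" by simp
    note pj = pred_index[OF Suc(4) pj]
    have "p = ps (i - 1)" using Suc(2) pi by simp
    from Suc(1)[OF this pi(1) pj(1)] show ?thesis using False Suc(2) pi pj by auto
  qed
  finally show ?case .
qed

lemma scalar_in_A: "scalar_matrix n r \<in> carrier A"
  unfolding mem_carrier_A_iff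
proof (intro conjI allI impI)
  fix i j assume ij: "i < n" "j < n"
  show "(if ps j = 0 then 0 else scalar_matrix n r $$ (i, j - 1)) =
    (if Suc (ps i) < sz i then scalar_matrix n r $$ (Suc i, j) else 0)"
    using ij succ_index[OF ij(1)] pred_index[OF ij(2)] 
    by (auto simp: scalar_matrix_def split: if_splits)
qed (auto simp: scalar_matrix_def)

lemma extension: "ring_hom_ring class_ring A (scalar_matrix n)"
proof -
  interpret A: ring A by (rule ring_centralizer_algebra[OF c_carrier])
  show ?thesis
  proof (rule ring_hom_ringI)
    show "ring (class_ring :: 'r ring)" by (rule class_ring.ring_axioms)
  qed (use scalar_in_A A.ring_axioms in \<open>auto simp: centralizer_algebra_simps scalar_matrix_add scalar_matrix_times scalar_matrix_one\<close>)
qed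

sublocale ext: ring_hom_ring class_ring A "scalar_matrix n"
  by (rule extension)

lemma carrier_A_mult: "a \<in> carrier A \<Longrightarrow> b \<in> carrier A \<Longrightarrow> a * b \<in> carrier A"
  using ext.S.m_closed by (simp add: centralizer_algebra_simps(2))

lemma carrier_A_add: "a \<in> carrier A \<Longrightarrow> b \<in> carrier A \<Longrightarrow> a + b \<in> carrier A"
  using ext.S.a_closed by (simp add: centralizer_algebra_simps(3))

lemma one_in_A: "1\<^sub>m n \<in> carrier A"
  using ext.S.one_closed by (simp add: centralizer_algebra_simps(4))

text \<open>Membership in the dual module up to the normalization of functions outside the carrier.\<close>

definition right_linear :: "('r mat \<Rightarrow> 'r) \<Rightarrow> bool" where
  "right_linear f \<longleftrightarrow>
     (\<forall>x\<in>carrier A. \<forall>y\<in>carrier A. f (x + y) = f x + f y) \<and>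
     (\<forall>x\<in>carrier A. \<forall>r. f (x * scalar_matrix n r) = f x * r)"

lemma right_dual_iff:
  "f \<in> carrier (right_dual class_ring (restricted_bimodule A (\<lambda>a. a) (scalar_matrix n))) \<longleftrightarrow>
     f \<in> extensional (carrier A) \<and> right_linear f"
  by (auto simp: right_dual_def right_hom_def hom_def right_linear_def centralizer_algebra_simps(2,3))

lemma right_dual_simps:
  fixes D defines "D \<equiv> right_dual class_ring (restricted_bimodule A (\<lambda>a. a) (scalar_matrix n))"
  shows "monoid.mult D = (\<lambda>f g. \<lambda>x\<in>carrier A. f x + g x)"
    "lact D = (\<lambda>b f. \<lambda>x\<in>carrier A. b * f x)"
    "ract D = (\<lambda>f a. \<lambda>x\<in>carrier A. f (a * x))"
  by (simp_all add: D_def right_dual_def centralizer_algebra_simps(2))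

text \<open>Moving \<open>k\<close> steps to the left from \<open>j\<close> without leaving the block.\<close>

lemma offset_index:
  assumes "j < n" "k \<le> ps j"
  shows "j - k < n" "ps (j - k) = ps j - k" "sz (j - k) = sz j" "ev (j - k) = ev j"
    "j - k - (ps j - k) = j - ps j" "k \<le> j"
proof -
  have b: "ps j \<le> j" "ps j < sz j" using block[OF assms(1)] by auto
  have "j - ps j + (ps j - k) = j - k" using b assms by simp
  then show "ps (j - k) = ps j - k" "sz (j - k) = sz j" "ev (j - k) = ev j"
    using same_block[OF assms(1), of "ps j - k"] b by auto
  show "j - k < n" "j - k - (ps j - k) = j - ps j" "k \<le> j" using b assms by auto
qed

text \<open>Prescribed first rows \<open>y\<close>, continued along the diagonals of the blocks.\<close>

definition toeplitz :: "(nat \<Rightarrow> nat \<Rightarrow> 'r) \<Rightarrow> 'r mat" where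
  "toeplitz y = mat n n (\<lambda>(i, j). if ev i = ev j \<and> ps i \<le> ps j then y (i - ps i) (j - ps i) else 0)"

lemma toeplitz_carrier [simp]: "toeplitz y \<in> carrier_mat n n"
  by (simp add: toeplitz_def)

lemma toeplitz_dims [simp]: "dim_row (toeplitz y) = n" "dim_col (toeplitz y) = n"
  by (simp_all add: toeplitz_def)

lemma toeplitz_index: "i < n \<Longrightarrow> j < n \<Longrightarrow>
  toeplitz y $$ (i, j) = (if ev i = ev j \<and> ps i \<le> ps j then y (i - ps i) (j - ps i) else 0)"
  by (simp add: toeplitz_def)

lemma toeplitz_of_A:
  assumes a: "a \<in> carrier A"
  shows "toeplitz (\<lambda>i j. a $$ (i, j)) = a"
proof (rule eq_matI)
  fix i j assume "i < dim_row a" "j < dim_col a"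
  then have ij: "i < n" "j < n" using carrier_A_mat[OF a] by auto
  show "toeplitz (\<lambda>i j. a $$ (i, j)) $$ (i, j) = a $$ (i, j)"
    unfolding toeplitz_index[OF ij]
    using carrier_A_off_eigenvalue[OF a ij] toeplitz_entry[OF a ij] by (cases "ev i = ev j") simp_all
qed (use carrier_A_mat[OF a] in auto)

lemma A_eqI:
  assumes a: "a \<in> carrier A" and b: "b \<in> carrier A"
    and eq: "\<And>i j. i < n \<Longrightarrow> j < n \<Longrightarrow> ps i = 0 \<Longrightarrow> ev i = ev j \<Longrightarrow> a $$ (i, j) = b $$ (i, j)"
  shows "a = b"
proof (rule eq_matI)
  fix i j assume "i < dim_row b" "j < dim_col b"
  then have ij: "i < n" "j < n" using carrier_A_mat[OF b] by auto
  show "a $$ (i, j) = b $$ (i, j)"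
  proof (cases "ev i = ev j \<and> ps i \<le> ps j")
    case True
    then show ?thesis using toeplitz_entry[OF a ij] toeplitz_entry[OF b ij]
        eq[of "i - ps i" "j - ps i"] head_index[OF ij(1)] offset_index[OF ij(2), of "ps i"] by simp
  next
    case False
    then show ?thesis
      using toeplitz_entry[OF a ij] toeplitz_entry[OF b ij]
        carrier_A_off_eigenvalue[OF a ij] carrier_A_off_eigenvalue[OF b ij] by auto
  qed
qed (use carrier_A_mat[OF a] carrier_A_mat[OF b] in auto)

lemma right_linear_restrict [simp]: "right_linear (restrict f (carrier A)) \<longleftrightarrow> right_linear f"
proof -
  have "x * scalar_matrix n r \<in> carrier A" if "x \<in> carrier A" for x r
    using carrier_A_mult[OF that scalar_in_A] .
  then show ?thesis by (simp add: right_linear_def carrier_A_add)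
qed

lemma right_linear_mult:
  assumes f: "right_linear f" and a: "a \<in> carrier A"
  shows "right_linear (\<lambda>x. f (a * x))"
  unfolding right_linear_def
proof (intro conjI ballI allI)
  fix x y assume xy: "x \<in> carrier A" "y \<in> carrier A"
  then have "a * (x + y) = a * x + a * y"
    using a by (intro mult_add_distrib_mat[of _ n n]) (auto dest: carrier_A_mat)
  then show "f (a * (x + y)) = f (a * x) + f (a * y)"
    using f xy a by (simp add: right_linear_def carrier_A_mult)
next
  fix x r assume x: "x \<in> carrier A"
  have "a * (x * scalar_matrix n r) = a * x * scalar_matrix n r"
    using assoc_mult_mat[OF carrier_A_mat[OF a] carrier_A_mat[OF x] scalar_matrix_carrier] by simp
  then show "f (a * (x * scalar_matrix n r)) = f (a * x) * r"
    using f x a by (simp add: right_linear_def carrier_A_mult)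
qed

context
  assumes equal_sizes: "\<And>i j. i < n \<Longrightarrow> j < n \<Longrightarrow> ev i = ev j \<Longrightarrow> sz i = sz j"
begin

text \<open>Equal sizes matter in the last row of a block: an entry there has nothing below it, so its left neighbour
must be zero. For square blocks that neighbour lies below the diagonal.\<close>

lemma toeplitz_in_A: "toeplitz y \<in> carrier A"
  unfolding mem_carrier_A_iff
proof (intro conjI allI impI toeplitz_carrier)
  fix i j assume ij: "i < n" "j < n"
  show "(if ps j = 0 then 0 else toeplitz y $$ (i, j - 1)) =
    (if Suc (ps i) < sz i then toeplitz y $$ (Suc i, j) else 0)"
  proof (cases "ps j = 0")
    case True
    then show ?thesis using succ_index[OF ij(1)] ij by (auto simp: toeplitz_index)
  next
    case False
    then have pj: "0 < ps j" by simp
    note j = pred_index[OF ij(2) pj]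
    show ?thesis
    proof (cases "Suc (ps i) < sz i")
      case True
      note i = succ_index[OF ij(1) True]
      have "j - Suc (ps i) = j - 1 - ps i" by simp
      moreover have "ps i \<le> ps (j - 1) \<longleftrightarrow> Suc (ps i) \<le> ps j" using j(3) by linarith
      ultimately show ?thesis using False True i(2-4) j(5)
        unfolding toeplitz_index[OF ij(1) j(1)] toeplitz_index[OF i(1) ij(2)] by simp
    next
      case last: False
      have "\<not> (ev i = ev (j - 1) \<and> ps i \<le> ps (j - 1))"
        using equal_sizes[OF ij(1) j(1)] last j(6) by auto
      then have "toeplitz y $$ (i, j - 1) = 0"
        unfolding toeplitz_index[OF ij(1) j(1)] by (rule if_not_P)
      then show ?thesis using last by simp
    qed
  qed
qed (auto simp: toeplitz_index)

text \<open>The retraction from all of \<open>R\<^bsup>n*n\<^esup>\<close> onto \<open>A\<close> keeps the first rows of the blocks and overwrites the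
other entries by continuing those rows.\<close>

lemma fg_projective: "fg_projective_right class_ring (restricted_bimodule A (\<lambda>a. a) (scalar_matrix n))"
proof -
  let ?M = "restricted_bimodule A (\<lambda>a. a) (scalar_matrix n)"
  let ?F = "free_bimodule (class_ring :: 'r ring) (n * n)"
  \<comment> \<open>Row-major order identifies matrices with vectors of length \<open>n * n\<close>.\<close>
  define i :: "'r mat \<Rightarrow> nat \<Rightarrow> 'r" where "i a = (\<lambda>k\<in>{..<n * n}. a $$ (k div n, k mod n))" for a
  define p :: "(nat \<Rightarrow> 'r) \<Rightarrow> 'r mat" where "p u = toeplitz (\<lambda>r s. u (r * n + s))" for u
  have dm: "k div n < n \<and> k mod n < n" if "k < n * n" for k
    using that by (metis less_mult_imp_div_less mod_less_divisor mult_is_0 neq0_conv not_less0)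
  have lt: "r * n + s < n * n" if "r < n" "s < n" for r s
  proof -
    have "r * n + s < Suc r * n" using that by simp
    also have "\<dots> \<le> n * n" using that by (intro mult_le_mono1) simp
    finally show ?thesis .
  qed
  have idx: "toeplitz y $$ (r, s) = toeplitz z $$ (r, s) * b"
    if "r < n" "s < n" "\<And>r s. r < n \<Longrightarrow> s < n \<Longrightarrow> y r s = z r s * b" for y z r s b
    using that head_index[OF that(1)] offset_index[OF that(2), of "ps r"] by (auto simp: toeplitz_index)
  have idx_add: "toeplitz y $$ (r, s) = toeplitz z $$ (r, s) + toeplitz w $$ (r, s)"
    if "r < n" "s < n" "\<And>r s. r < n \<Longrightarrow> s < n \<Longrightarrow> y r s = z r s + w r s" for y z w r s
    using that head_index[OF that(1)] offset_index[OF that(2), of "ps r"] by (auto simp: toeplitz_index)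
  have "i \<in> right_hom class_ring ?M ?F"
    unfolding right_hom_def hom_def
  proof (intro CollectI conjI ballI Pi_I)
    fix x y b assume x: "x \<in> carrier ?M" and y: "y \<in> carrier ?M"
    then have xy: "x \<in> carrier_mat n n" "y \<in> carrier_mat n n" using carrier_A_mat by auto
    show "i x \<in> carrier ?F" by (auto simp: i_def free_bimodule_def)
    show "i (x \<otimes>\<^bsub>?M\<^esub> y) = i x \<otimes>\<^bsub>?F\<^esub> i y"
      using dm xy by (auto simp: i_def free_bimodule_def centralizer_algebra_simps(3) fun_eq_iff)
    show "i (ract ?M x b) = ract ?F (i x) b"
      using dm xy by (auto simp: i_def free_bimodule_def centralizer_algebra_simps(2) fun_eq_iff scalar_matrix_mult)
  qed
  moreover have "p \<in> right_hom class_ring ?F ?M"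
    unfolding right_hom_def hom_def
  proof (intro CollectI conjI ballI Pi_I)
    fix u v b
    show "p u \<in> carrier ?M" by (simp add: p_def toeplitz_in_A)
    show "p (u \<otimes>\<^bsub>?F\<^esub> v) = p u \<otimes>\<^bsub>?M\<^esub> p v"
    proof (rule eq_matI)
      fix r s assume "r < dim_row (p u \<otimes>\<^bsub>?M\<^esub> p v)" "s < dim_col (p u \<otimes>\<^bsub>?M\<^esub> p v)"
      then have rs: "r < n" "s < n" by (auto simp: p_def centralizer_algebra_simps(3) toeplitz_def)
      show "p (u \<otimes>\<^bsub>?F\<^esub> v) $$ (r, s) = (p u \<otimes>\<^bsub>?M\<^esub> p v) $$ (r, s)"
        using rs lt by (auto simp: p_def centralizer_algebra_simps(3) free_bimodule_def intro!: idx_add)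
    qed (auto simp: p_def centralizer_algebra_simps(3) toeplitz_def)
    show "p (ract ?F u b) = ract ?M (p u) b"
    proof (rule eq_matI)
      fix r s assume "r < dim_row (ract ?M (p u) b)" "s < dim_col (ract ?M (p u) b)"
      then have rs: "r < n" "s < n" by (auto simp: p_def centralizer_algebra_simps(2) toeplitz_def scalar_matrix_def)
      show "p (ract ?F u b) $$ (r, s) = ract ?M (p u) b $$ (r, s)"
        using rs lt by (auto simp: p_def centralizer_algebra_simps(2) scalar_matrix_mult free_bimodule_def intro!: idx)
    qed (auto simp: p_def centralizer_algebra_simps(2) toeplitz_def scalar_matrix_def)
  qed
  moreover have "p (i x) = x" if "x \<in> carrier ?M" for x
  proof -
    have x: "x \<in> carrier A" using that by simp
    have "p (i x) = toeplitz (\<lambda>r s. x $$ (r, s))"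
    proof (rule eq_matI)
      fix r s assume "r < dim_row (toeplitz (\<lambda>r s. x $$ (r, s)))" "s < dim_col (toeplitz (\<lambda>r s. x $$ (r, s)))"
      then have rs: "r < n" "s < n" by (auto simp: toeplitz_def)
      then show "p (i x) $$ (r, s) = toeplitz (\<lambda>r s. x $$ (r, s)) $$ (r, s)"
        using lt idx[OF rs, of "\<lambda>r s. i x (r * n + s)" "\<lambda>r s. x $$ (r, s)" 1] by (simp add: p_def i_def)
    qed (auto simp: p_def toeplitz_def)
    then show ?thesis using toeplitz_of_A[OF x] by simp
  qed
  ultimately show ?thesis unfolding fg_projective_right_def by blast
qed

text \<open>The free coordinates: \<open>(u, v)\<close> is the entry of the first row \<open>u\<close> of a block in the column \<open>v\<close>.\<close>

definition basis_pairs :: "(nat \<times> nat) set" where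
  "basis_pairs = {(u, v). u < n \<and> v < n \<and> ps u = 0 \<and> ev u = ev v}"

definition basis_mat :: "nat \<Rightarrow> nat \<Rightarrow> 'r mat" where
  "basis_mat u v = toeplitz (\<lambda>i j. if i = u \<and> j = v then 1 else 0)"

text \<open>The matrices \<open>basis_mat u v\<close> span \<open>A\<close> over \<open>R\<close>, with the entries at the basis pairs as coordinates.\<close>

lemma right_linear_expand:
  assumes f: "right_linear f" and x: "x \<in> carrier A"
  shows "f x = (\<Sum>(u, v)\<in>basis_pairs. f (basis_mat u v) * x $$ (u, v))"
proof -
  \<comment> \<open>The part of \<open>x\<close> supported on the coordinates in \<open>L\<close>; it stays in \<open>A\<close>, so \<open>f\<close> can be added up one coordinate at a time.\<close>
  define X where "X L = toeplitz (\<lambda>i j. if (i, j) \<in> L then x $$ (i, j) else 0)" for L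
  have XA: "X L \<in> carrier A" for L by (simp add: X_def toeplitz_in_A)
  have bA: "basis_mat u v \<in> carrier A" for u v by (simp add: basis_mat_def toeplitz_in_A)
  have fin: "finite basis_pairs"
    by (rule finite_subset[of _ "{..<n} \<times> {..<n}"]) (auto simp: basis_pairs_def)
  have "f (X L) = (\<Sum>(u, v)\<in>L. f (basis_mat u v) * x $$ (u, v))" if "finite L" "L \<subseteq> basis_pairs" for L
    using that
  proof (induct rule: finite_induct)
    case empty
    have "X {} + X {} = X {}" by (rule eq_matI) (auto simp: X_def toeplitz_def)
    then have "f (X {}) + f (X {}) = f (X {})" using f XA by (metis right_linear_def)
    then show ?case by simp
  next
    case (insert p L)
    obtain u v where p: "p = (u, v)" by (cases p)
    have c: "basis_mat u v \<in> carrier_mat n n" using carrier_A_mat[OF bA] .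
    have "X (insert p L) = X L + basis_mat u v * scalar_matrix n (x $$ (u, v))"
    proof (rule eq_matI)
      fix i j assume "i < dim_row (X L + basis_mat u v * scalar_matrix n (x $$ (u, v)))"
        "j < dim_col (X L + basis_mat u v * scalar_matrix n (x $$ (u, v)))"
      then have ij: "i < n" "j < n" by (auto simp: X_def basis_mat_def toeplitz_def scalar_matrix_def)
      then show "X (insert p L) $$ (i, j) = (X L + basis_mat u v * scalar_matrix n (x $$ (u, v))) $$ (i, j)"
        using insert(2) p carrier_matD[OF c]
        by (simp add: scalar_matrix_mult(2)[OF c ij] carrier_matD[OF scalar_matrix_carrier])
          (auto simp: X_def basis_mat_def toeplitz_index)
    qed (auto simp: X_def basis_mat_def toeplitz_def scalar_matrix_def)
    then have "f (X (insert p L)) = f (X L) + f (basis_mat u v) * x $$ (u, v)"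
      using f XA bA carrier_A_mult[OF bA scalar_in_A] by (simp add: right_linear_def)
    then show ?case using insert p by (simp add: add.commute)
  qed
  from this[OF fin subset_refl] have "f (X basis_pairs) = (\<Sum>(u, v)\<in>basis_pairs. f (basis_mat u v) * x $$ (u, v))" .
  moreover have "X basis_pairs = x"
    by (rule A_eqI[OF XA x]) (auto simp: X_def toeplitz_index basis_pairs_def)
  ultimately show ?thesis by simp
qed

text \<open>The Frobenius functional. The top right corner of a diagonal block is its coefficient of \<open>x\<^bsup>m-1\<^esup>\<close>.\<close>

definition corner_sum :: "'r mat \<Rightarrow> 'r" where
  "corner_sum a = (\<Sum>i | i < n \<and> ps i = 0. a $$ (i, i + sz i - 1))"

lemma corner_index:
  assumes "i < n" "ps i = 0"
  shows "i + sz i - 1 < n" "ps (i + sz i - 1) = sz i - 1" "ev (i + sz i - 1) = ev i"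
    "sz (i + sz i - 1) = sz i" "0 < sz i"
  using block[OF assms(1)] block_index[OF assms, of "sz i - 1"] by auto

lemma right_linear_corner_sum: "right_linear corner_sum"
  unfolding right_linear_def
proof (intro conjI ballI allI)
  fix x y assume xy: "x \<in> carrier A" "y \<in> carrier A"
  show "corner_sum (x + y) = corner_sum x + corner_sum y"
    unfolding corner_sum_def sum.distrib[symmetric]
    using corner_index(1) carrier_matD[OF carrier_A_mat[OF xy(2)]]
    by (intro sum.cong refl) (simp del: One_nat_def)
next
  fix x r assume x: "x \<in> carrier A"
  show "corner_sum (x * scalar_matrix n r) = corner_sum x * r"
    unfolding corner_sum_def sum_distrib_right
    using corner_index(1) scalar_matrix_mult(2)[OF carrier_A_mat[OF x]] by (intro sum.cong refl) blast
qed

lemma corner_sum_scalar: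
  assumes "x \<in> carrier_mat n n"
  shows "corner_sum (scalar_matrix n r * x) = r * corner_sum x"
  unfolding corner_sum_def sum_distrib_left
  using corner_index(1) scalar_matrix_mult(1)[OF assms] by (intro sum.cong refl) blast

text \<open>If \<open>v\<close> is at position \<open>k\<close> of its block, the matrix of \<open>(u, v)\<close> represents \<open>x\<^sup>k\<close> between two blocks. Its
partner represents \<open>x\<^bsup>m-1-k\<^esup>\<close> in the opposite direction, where \<open>m\<close> is the common size.\<close>

definition dual_pair :: "nat \<times> nat \<Rightarrow> nat \<times> nat" where
  "dual_pair = (\<lambda>(u, v). (v - ps v, u + sz u - 1 - ps v))"

lemma dual_pair:
  assumes "(u, v) \<in> basis_pairs"
  shows "dual_pair (u, v) \<in> basis_pairs" "dual_pair (dual_pair (u, v)) = (u, v)"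
proof -
  have uv: "u < n" "v < n" "ps u = 0" "ev u = ev v" using assms by (auto simp: basis_pairs_def)
  have s: "sz u = sz v" using equal_sizes uv by blast
  note b = block[OF uv(2)]
  have k: "u + sz u - 1 - ps v = u + (sz u - 1 - ps v)" using b s by simp
  have "sz u - 1 - ps v < sz u" using b s by simp
  note w = block_index[OF uv(1,3) this]
  note h = head_index[OF uv(2)]
  show "dual_pair (u, v) \<in> basis_pairs"
    unfolding dual_pair_def case_prod_conv k using w h uv by (simp add: basis_pairs_def)
  show "dual_pair (dual_pair (u, v)) = (u, v)"
    unfolding dual_pair_def case_prod_conv k using w h uv b s by simp
qed

text \<open>Duality of the two bases: pairing with a basis matrix reads off a single coordinate.\<close>

lemma corner_sum_mult_basis:
  assumes a: "a \<in> carrier_mat n n" and uv: "(u, v) \<in> basis_pairs"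
  shows "corner_sum (a * basis_mat u v) = a $$ dual_pair (u, v)"
proof -
  have u: "u < n" "v < n" "ps u = 0" "ev u = ev v" using uv by (auto simp: basis_pairs_def)
  have s: "sz u = sz v" using equal_sizes u by blast
  obtain i0 k0 where d: "dual_pair (u, v) = (i0, k0)" by (cases "dual_pair (u, v)")
  have ik: "i0 < n" "k0 < n" "ps i0 = 0" using dual_pair(1)[OF uv] d by (auto simp: basis_pairs_def)
  \<comment> \<open>Only the last columns of the blocks enter \<open>corner_sum\<close>; there the basis matrix has at most one nonzero entry.\<close>
  have B: "basis_mat u v $$ (k, i + sz i - 1) = (if i = i0 \<and> k = k0 then 1 else 0)"
    if i: "i < n" "ps i = 0" and k: "k < n" for i k
  proof -
    note l = corner_index[OF i]
    have "ev k = ev (i + sz i - 1) \<and> ps k \<le> ps (i + sz i - 1) \<and> k - ps k = u \<and> i + sz i - 1 - ps k = v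
      \<longleftrightarrow> i = i0 \<and> k = k0"
    proof
      assume *: "ev k = ev (i + sz i - 1) \<and> ps k \<le> ps (i + sz i - 1) \<and> k - ps k = u \<and> i + sz i - 1 - ps k = v"
      have sk: "sz k = sz i" using equal_sizes[OF k i(1)] * l by simp
      have v: "v = i + (sz i - 1 - ps k)" using * l by auto
      have "sz i - 1 - ps k < sz i" using l by simp
      note w = block_index[OF i this]
      have "sz u = sz k" using * head_index[OF k] by auto
      then show "i = i0 \<and> k = k0"
        using w v * block[OF k] d sk by (auto simp: dual_pair_def)
    next
      assume *: "i = i0 \<and> k = k0"
      have "(u, v) = dual_pair (i, k)" using dual_pair(2)[OF uv] d * by simp
      then have uv': "u = k - ps k" "v = i + sz i - 1 - ps k" by (auto simp: dual_pair_def)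
      have e: "ev k = ev i" using dual_pair(1)[OF uv] d * by (simp add: basis_pairs_def)
      have "ps k < sz i" using equal_sizes[OF k i(1) e] block[OF k] by simp
      then show "ev k = ev (i + sz i - 1) \<and> ps k \<le> ps (i + sz i - 1) \<and> k - ps k = u \<and> i + sz i - 1 - ps k = v"
        using uv' e l by simp
    qed
    then show ?thesis unfolding basis_mat_def toeplitz_index[OF k l(1)] by auto
  qed
  have Bc: "basis_mat u v \<in> carrier_mat n n" by (simp add: basis_mat_def)
  have "corner_sum (a * basis_mat u v) = (\<Sum>i | i < n \<and> ps i = 0. \<Sum>k<n. a $$ (i, k) * basis_mat u v $$ (k, i + sz i - 1))"
    unfolding corner_sum_def using corner_index(1)
    by (intro sum.cong refl index_mult_mat_sum[OF a Bc]) auto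
  also have "\<dots> = (\<Sum>i | i < n \<and> ps i = 0. \<Sum>k<n. if k = k0 then if i = i0 then a $$ (i0, k0) else 0 else 0)"
    using B by (intro sum.cong refl) auto
  also have "\<dots> = a $$ (i0, k0)" using ik by simp
  finally show ?thesis using d by simp
qed

text \<open>By duality, equal functionals \<open>corner_sum (a \<cdot> _)\<close> have equal coordinates, and a given right linear
functional is realized by taking its values on the dual basis as coordinates of \<open>a\<close>.\<close>

proposition frobenius_if_equal_sizes: "frobenius_extension class_ring A (scalar_matrix n)"
proof -
  let ?D = "right_dual class_ring (restricted_bimodule A (\<lambda>a. a) (scalar_matrix n))"
  let ?M = "restricted_bimodule A (scalar_matrix n) (\<lambda>a. a)"
  define \<phi> where "\<phi> a = (\<lambda>x\<in>carrier A. corner_sum (a * x))" for a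
  have \<phi>D: "\<phi> a \<in> carrier ?D" if "a \<in> carrier A" for a
    unfolding \<phi>_def right_dual_iff using right_linear_mult[OF right_linear_corner_sum that] by simp
  have assoc: "a * b * x = a * (b * x)" if "a \<in> carrier A" "b \<in> carrier A" "x \<in> carrier A" for a b x
    using that by (intro assoc_mult_mat[of _ n n _ n _ n]) (auto dest: carrier_A_mat)
  have "\<phi> \<in> bimodule_hom class_ring A ?M ?D"
    unfolding bimodule_hom_def right_hom_def hom_def
  proof (intro CollectI conjI ballI Pi_I)
    fix a b assume ab: "a \<in> carrier ?M" "b \<in> carrier ?M"
    have "(a + b) * x = a * x + b * x" if "x \<in> carrier A" for x
      using ab that by (intro add_mult_distrib_mat[of _ n n]) (auto dest: carrier_A_mat)
    then show "\<phi> (a \<otimes>\<^bsub>?M\<^esub> b) = \<phi> a \<otimes>\<^bsub>?D\<^esub> \<phi> b"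
      using ab right_linear_corner_sum
      by (auto simp: \<phi>_def right_dual_simps centralizer_algebra_simps(3) right_linear_def carrier_A_mult fun_eq_iff)
  next
    fix a b assume ab: "a \<in> carrier ?M" "b \<in> carrier A"
    then show "\<phi> (ract ?M a b) = ract ?D (\<phi> a) b"
      by (auto simp: \<phi>_def right_dual_simps centralizer_algebra_simps(2) carrier_A_mult fun_eq_iff assoc)
  next
    fix r a assume a: "a \<in> carrier ?M"
    have "corner_sum (scalar_matrix n r * a * x) = r * corner_sum (a * x)" if "x \<in> carrier A" for x
      using a that corner_sum_scalar[OF carrier_A_mat[OF carrier_A_mult]] by (simp add: assoc scalar_in_A)
    then show "\<phi> (lact ?M r a) = lact ?D r (\<phi> a)"
      by (auto simp: \<phi>_def right_dual_simps centralizer_algebra_simps(2) fun_eq_iff)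
  qed (use \<phi>D in auto)
  moreover have "bij_betw \<phi> (carrier ?M) (carrier ?D)"
  proof (rule bij_betwI')
    fix a b assume "a \<in> carrier ?M" "b \<in> carrier ?M"
    then have ab: "a \<in> carrier A" "b \<in> carrier A" by auto
    have "a = b" if eq: "\<phi> a = \<phi> b"
    proof (rule A_eqI[OF ab])
      fix i j assume "i < n" "j < n" "ps i = 0" "ev i = ev j"
      then have ij: "(i, j) \<in> basis_pairs" by (simp add: basis_pairs_def)
      obtain u v where d: "dual_pair (i, j) = (u, v)" by (cases "dual_pair (i, j)")
      have uv: "(u, v) \<in> basis_pairs" "dual_pair (u, v) = (i, j)" using dual_pair[OF ij] d by auto
      have "\<phi> a (basis_mat u v) = \<phi> b (basis_mat u v)" using eq by simp
      then show "a $$ (i, j) = b $$ (i, j)"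
        using corner_sum_mult_basis[OF carrier_A_mat uv(1)] ab uv(2)
        by (simp add: \<phi>_def basis_mat_def toeplitz_in_A)
    qed
    then show "\<phi> a = \<phi> b \<longleftrightarrow> a = b" by blast
  next
    fix a assume "a \<in> carrier ?M" then show "\<phi> a \<in> carrier ?D" using \<phi>D by simp
  next
    fix f assume "f \<in> carrier ?D"
    then have f: "f \<in> extensional (carrier A)" "right_linear f" by (auto simp: right_dual_iff)
    \<comment> \<open>The coordinate at a pair is the value of \<open>f\<close> at the basis matrix of the dual pair.\<close>
    define a where "a = toeplitz (\<lambda>i j. f (case_prod basis_mat (dual_pair (i, j))))"
    have a: "a \<in> carrier A" by (simp add: a_def toeplitz_in_A)
    have basis: "corner_sum (a * basis_mat u v) = f (basis_mat u v)" if uv: "(u, v) \<in> basis_pairs" for u v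
    proof -
      obtain i j where d: "dual_pair (u, v) = (i, j)" by (cases "dual_pair (u, v)")
      have ij: "i < n" "j < n" "ps i = 0" "ev i = ev j" using dual_pair(1)[OF uv] d by (auto simp: basis_pairs_def)
      have "dual_pair (i, j) = (u, v)" using dual_pair(2)[OF uv] d by simp
      then show ?thesis using corner_sum_mult_basis[OF carrier_A_mat[OF a] uv] ij d
        by (simp add: a_def toeplitz_index)
    qed
    have "f x = \<phi> a x" for x
    proof (cases "x \<in> carrier A")
      case True
      have "corner_sum (a * x) = (\<Sum>(u, v)\<in>basis_pairs. corner_sum (a * basis_mat u v) * x $$ (u, v))"
        by (rule right_linear_expand[OF right_linear_mult[OF right_linear_corner_sum a] True])
      also have "\<dots> = f x" unfolding right_linear_expand[OF f(2) True]
        using basis by (intro sum.cong) auto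
      finally show ?thesis using True by (simp add: \<phi>_def)
    next
      case False
      then show ?thesis using f(1) by (simp add: \<phi>_def extensional_def)
    qed
    then show "\<exists>a\<in>carrier ?M. f = \<phi> a" using a by auto
  qed
  ultimately have "bimodule_isomorphic class_ring A ?M ?D" unfolding bimodule_isomorphic_def by blast
  then show ?thesis using fg_projective extension by (simp add: frobenius_extension_def)
qed

end

text \<open>An isomorphism of \<open>A\<close> with its dual makes \<open>A\<close> injective relative to \<open>R\<close>. Hence the isomorphism \<open>t x \<mapsto> s x\<close>
between the right ideals of two matrix units \<open>s\<close> and \<open>t\<close> is a left multiplication, which the
shape of the blocks forbids.\<close>

proposition no_smaller_block_if_frobenius:
  assumes frob: "frobenius_extension class_ring A (scalar_matrix n)"
    and ij: "i < n" "j < n" "ev i = ev j"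
  shows "\<not> sz i < sz j"
proof
  assume less: "sz i < sz j"
  let ?D = "right_dual class_ring (restricted_bimodule A (\<lambda>a. a) (scalar_matrix n))"
  let ?M = "restricted_bimodule A (scalar_matrix n) (\<lambda>a. a)"
  obtain \<phi> where hom: "\<phi> \<in> bimodule_hom class_ring A ?M ?D" and bij: "bij_betw \<phi> (carrier ?M) (carrier ?D)"
    using frob by (auto simp: frobenius_extension_def bimodule_isomorphic_def)
  define E where "E = \<phi> (1\<^sub>m n)"
  have "\<phi> (ract ?M x b) = ract ?D (\<phi> x) b" if "x \<in> carrier ?M" "b \<in> carrier A" for x b
    using hom that unfolding bimodule_hom_def right_hom_def by blast
  from this[of "1\<^sub>m n"] have unit: "\<phi> (1\<^sub>m n * a) = (\<lambda>x\<in>carrier A. E (a * x))" if "a \<in> carrier A" for a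
    using that one_in_A by (simp add: right_dual_simps centralizer_algebra_simps(2) E_def)
  have \<phi>: "\<phi> a x = E (a * x)" if "a \<in> carrier A" "x \<in> carrier A" for a x
  proof -
    have "\<phi> a = (\<lambda>x\<in>carrier A. E (a * x))"
      using unit[OF that(1)] by (simp only: left_mult_one_mat[OF carrier_A_mat[OF that(1)]])
    then show ?thesis using that by simp
  qed
  have E: "right_linear E"
    using bij_betwE[OF bij] one_in_A by (simp add: E_def right_dual_iff)

  \<comment> \<open>The first row of the smaller block, the first row and the last row of the larger block.\<close>
  define a' a b where "a' = i - ps i" and "a = j - ps j" and "b = a + (sz a - 1)"
  have a': "a' < n" "ps a' = 0" "sz a' = sz i" "ev a' = ev i" using head_index[OF ij(1)] by (auto simp: a'_def)
  have a: "a < n" "ps a = 0" "sz a = sz j" "ev a = ev j" using head_index[OF ij(2)] by (auto simp: a_def)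
  have pos: "0 < sz a" using less a by simp
  have b: "b < n" "ps b = sz a - 1" "sz b = sz a" "ev b = ev a"
    using block_index[OF a(1,2), of "sz a - 1"] pos by (auto simp: b_def)
  \<comment> \<open>This copies row \<open>a\<close> to row \<open>r\<close>, keeping only the last columns of blocks with this eigenvalue. Matrix units from the
    last column of one block to the first row of another always commute with \<open>N\<close>, so the result lies in \<open>A\<close> for every \<open>y\<close>.\<close>
  define row where "row r y = mat n n (\<lambda>(s, k). if s = r \<and> Suc (ps k) = sz k \<and> ev k = ev a then y $$ (a, k) else 0)"
    for r and y :: "'r mat"
  have row_index: "row r y $$ (s, k) = (if s = r \<and> Suc (ps k) = sz k \<and> ev k = ev a then y $$ (a, k) else 0)"
    if "s < n" "k < n" for r y s k using that by (simp add: row_def)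
  have row_A: "row r y \<in> carrier A" if r: "r < n" "ps r = 0" "ev r = ev a" for r y
    unfolding mem_carrier_A_iff
  proof (intro conjI allI impI)
    show "row r y \<in> carrier_mat n n" by (simp add: row_def)
  next
    fix s k assume "s < n" "k < n" "ev s \<noteq> ev k"
    then show "row r y $$ (s, k) = 0" using r by (auto simp: row_index)
  next
    fix s k assume sk: "s < n" "k < n"
    have "(if ps k = 0 then 0 else row r y $$ (s, k - 1)) = 0"
      using pred_index[OF sk(2)] sk by (auto simp: row_index)
    moreover have "(if Suc (ps s) < sz s then row r y $$ (Suc s, k) else 0) = 0"
      using succ_index[OF sk(1)] sk r by (auto simp: row_index)
    ultimately show "(if ps k = 0 then 0 else row r y $$ (s, k - 1)) =
      (if Suc (ps s) < sz s then row r y $$ (Suc s, k) else 0)" by simp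
  qed
  define s t where "s = (unit_mat n a' b :: 'r mat)" and "t = (unit_mat n a b :: 'r mat)"
  have "s = row a' (unit_mat n a b)" "t = row a (unit_mat n a b)"
    using a b pos by (auto intro!: eq_matI simp: s_def t_def row_def unit_mat_def)
  then have sA: "s \<in> carrier A" and tA: "t \<in> carrier A"
    using row_A a a' ij by auto
  \<comment> \<open>Row \<open>b\<close> of \<open>x\<close>, the last one of its block, is supported on the columns that \<open>row\<close> keeps.\<close>
  have row_t: "row a' (t * x) = s * x" if x: "x \<in> carrier A" for x
  proof (rule eq_matI)
    fix r k assume "r < dim_row (s * x)" "k < dim_col (s * x)"
    then have rk: "r < n" "k < n" using carrier_A_mat[OF x] by (auto simp: s_def unit_mat_def)
    have "x $$ (b, k) = 0" if "\<not> (Suc (ps k) = sz k \<and> ev k = ev a)"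
    proof (cases "ev k = ev a")
      case False then show ?thesis using carrier_A_off_eigenvalue[OF x b(1) rk(2)] b by simp
    next
      case True
      then have k: "Suc (ps k) < sz k" using that block[OF rk(2)] by auto
      note k' = succ_index[OF rk(2) k]
      show ?thesis using carrier_A_shift[OF x b(1) k'(1)] k'(2) b(2,3) pos by simp
    qed
    then show "row a' (t * x) $$ (r, k) = (s * x) $$ (r, k)"
      using rk a a' b carrier_A_mat[OF x]
      by (auto simp: row_index s_def t_def unit_mat_mult(1))
  qed (use carrier_A_mat[OF x] in \<open>auto simp: s_def unit_mat_def row_def\<close>)
  \<comment> \<open>A right linear functional on all of \<open>A\<close> that extends \<open>t x \<mapsto> E (s x)\<close>.\<close>
  define g where "g = (\<lambda>y\<in>carrier A. E (row a' y))"
  have a'e: "ev a' = ev a" using a a' ij by simp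
  have "right_linear g"
    unfolding g_def right_linear_restrict
    unfolding right_linear_def
  proof (intro conjI ballI allI)
    fix x y assume xy: "x \<in> carrier A" "y \<in> carrier A"
    have "row a' (x + y) = row a' x + row a' y"
      using carrier_A_mat[OF xy(1)] carrier_A_mat[OF xy(2)] a by (intro eq_matI) (auto simp: row_def)
    then show "E (row a' (x + y)) = E (row a' x) + E (row a' y)"
      using E row_A[OF a'(1,2) a'e] by (simp add: right_linear_def)
  next
    fix x r assume x: "x \<in> carrier A"
    have "row a' (x * scalar_matrix n r) = row a' x * scalar_matrix n r"
    proof (rule eq_matI)
      fix s k assume "s < dim_row (row a' x * scalar_matrix n r)" "k < dim_col (row a' x * scalar_matrix n r)"
      then have sk: "s < n" "k < n" by (auto simp: row_def scalar_matrix_def)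
      show "row a' (x * scalar_matrix n r) $$ (s, k) = (row a' x * scalar_matrix n r) $$ (s, k)"
        using sk a scalar_matrix_mult(2)[OF carrier_A_mat[OF x]]
          scalar_matrix_mult(2)[OF carrier_A_mat[OF row_A[OF a'(1,2) a'e]]] by (simp add: row_index)
    qed (auto simp: row_def scalar_matrix_def)
    then show "E (row a' (x * scalar_matrix n r)) = E (row a' x) * r"
      using E row_A[OF a'(1,2) a'e] by (simp add: right_linear_def)
  qed
  then have "g \<in> carrier ?D" by (simp add: right_dual_iff g_def)
  then have "g \<in> \<phi> ` carrier A" using bij by (simp add: bij_betw_def)
  then obtain w where w: "w \<in> carrier A" "\<phi> w = g" by blast
  have "\<phi> (w * t) x = \<phi> s x" for x
  proof (cases "x \<in> carrier A")
    case True
    have "\<phi> (w * t) x = E (w * (t * x))"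
      using \<phi>[OF carrier_A_mult[OF w(1) tA] True]
        assoc_mult_mat[OF carrier_A_mat[OF w(1)] carrier_A_mat[OF tA] carrier_A_mat[OF True]] by simp
    also have "\<dots> = \<phi> w (t * x)" using \<phi>[OF w(1) carrier_A_mult[OF tA True]] by simp
    also have "\<dots> = E (row a' (t * x))" using w(2) carrier_A_mult[OF tA True] by (simp add: g_def)
    also have "\<dots> = \<phi> s x" using row_t[OF True] \<phi>[OF sA True] by simp
    finally show ?thesis .
  next
    case False
    have "\<phi> (w * t) \<in> extensional (carrier A)" "\<phi> s \<in> extensional (carrier A)"
      using bij_betwE[OF bij] carrier_A_mult[OF w(1) tA] sA by (simp_all add: right_dual_iff)
    then show ?thesis using False by (simp add: extensional_def)
  qed
  then have "\<phi> (w * t) = \<phi> s" by blast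
  then have "w * t = s"
    using bij carrier_A_mult[OF w(1) tA] sA by (auto simp: bij_betw_def dest: inj_onD)
  then have "w $$ (a', a) = 1"
    using unit_mat_mult(2)[OF carrier_A_mat[OF w(1)] a(1) b(1) a'(1) b(1)] a' b
    by (simp add: s_def t_def unit_mat_index)
  \<comment> \<open>Descending along the diagonal from \<open>(a', a)\<close> reaches the last row of the smaller block before the last column of the larger one.\<close>
  moreover have "w $$ (a', a) = 0"
  proof -
    define l where "l = a' + (sz a' - 1)"
    have pos': "0 < sz a'" using block[OF a'(1)] by auto
    have l: "l < n" "ps l = sz a' - 1" "sz l = sz a'" "l - ps l = a'"
      using block_index[OF a'(1,2), of "sz a' - 1"] pos' by (auto simp: l_def)
    have lt: "sz a' < sz a" using less a a' by simp
    note m = block_index[OF a(1,2) lt]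
    have lt': "sz a' - 1 < sz a" using lt by simp
    note m' = block_index[OF a(1,2) lt']
    have "w $$ (l, a + sz a' - 1) = 0"
      using carrier_A_shift[OF w(1) l(1) m(1)] m(2) l pos' by simp
    moreover have "w $$ (l, a + (sz a' - 1)) = w $$ (a', a)"
      using toeplitz_entry[OF w(1) l(1) m'(1)] m'(2) l by simp
    ultimately show ?thesis using pos' by simp
  qed
  ultimately show False by simp
qed

section \<open>Separability\<close>

text \<open>The matrix \<open>N\<close>: what remains of \<open>c\<close> without its diagonal.\<close>

definition nilp :: "'r mat" where
  "nilp = mat n n (\<lambda>(i, j). if j = Suc i \<and> Suc (ps i) < sz i then 1 else 0)"

definition nilp_transpose :: "'r mat" where
  "nilp_transpose = mat n n (\<lambda>(i, j). if i = Suc j \<and> Suc (ps j) < sz j then 1 else 0)"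

lemma nilp_carrier [simp]: "nilp \<in> carrier_mat n n" "nilp_transpose \<in> carrier_mat n n"
  by (simp_all add: nilp_def nilp_transpose_def)

lemma nilp_mult_index:
  assumes "a \<in> carrier_mat n n" "i < n" "j < n"
  shows "(nilp * a) $$ (i, j) = (if Suc (ps i) < sz i then a $$ (Suc i, j) else 0)"
proof -
  have "(nilp * a) $$ (i, j) = (\<Sum>k<n. if k = Suc i then if Suc (ps i) < sz i then a $$ (Suc i, j) else 0 else 0)"
    unfolding index_mult_mat_sum[OF nilp_carrier(1) assms]
    using assms by (intro sum.cong) (auto simp: nilp_def)
  also have "\<dots> = (if Suc (ps i) < sz i then a $$ (Suc i, j) else 0)"
    using succ_index(1)[OF assms(2)] by auto
  finally show ?thesis .
qed

lemma mult_nilp_index: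
  assumes "a \<in> carrier_mat n n" "i < n" "j < n"
  shows "(a * nilp) $$ (i, j) = (if ps j = 0 then 0 else a $$ (i, j - 1))"
proof -
  have "nilp $$ (k, j) = (if 0 < ps j \<and> k = j - 1 then 1 else 0)" if "k < n" for k
  proof -
    have "j = Suc k \<and> Suc (ps k) < sz k \<longleftrightarrow> 0 < ps j \<and> k = j - 1"
      using succ_index(2)[OF that] pred_index(2,6)[OF assms(3)] by (metis diff_Suc_1 zero_less_Suc)
    then show ?thesis using that assms(3) by (simp add: nilp_def)
  qed
  then have "(a * nilp) $$ (i, j) = (\<Sum>k<n. if k = j - 1 then if ps j = 0 then 0 else a $$ (i, j - 1) else 0)"
    unfolding index_mult_mat_sum[OF assms(1) nilp_carrier(1) assms(2,3)]
    by (intro sum.cong) auto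
  also have "\<dots> = (if ps j = 0 then 0 else a $$ (i, j - 1))"
    using assms(3) by auto
  finally show ?thesis .
qed

lemma nilp_central:
  assumes "a \<in> carrier A"
  shows "a * nilp = nilp * a"
proof (rule eq_matI)
  note a = carrier_A_mat[OF assms]
  fix i j assume "i < dim_row (nilp * a)" "j < dim_col (nilp * a)"
  then have ij: "i < n" "j < n" using a by (auto simp: nilp_def)
  show "(a * nilp) $$ (i, j) = (nilp * a) $$ (i, j)"
    unfolding nilp_mult_index[OF a ij] mult_nilp_index[OF a ij] by (rule carrier_A_shift[OF assms ij])
qed (use carrier_A_mat[OF assms] in \<open>auto simp: nilp_def\<close>)

text \<open>\<open>N\<close> moves basis vectors to basis vectors or to zero, and its transpose moves them back.\<close>

lemma nilp_partial_isometry: "nilp * (nilp_transpose * nilp) = nilp"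
proof (rule eq_matI)
  fix i j assume "i < dim_row nilp" "j < dim_col nilp"
  then have ij: "i < n" "j < n" by (auto simp: nilp_def)
  have c: "nilp_transpose * nilp \<in> carrier_mat n n" by (rule mult_carrier_mat[OF nilp_carrier(2,1)])
  show "(nilp * (nilp_transpose * nilp)) $$ (i, j) = nilp $$ (i, j)"
  proof (cases "Suc (ps i) < sz i")
    case False
    then show ?thesis using nilp_mult_index[OF c ij] ij by (simp add: nilp_def)
  next
    case True
    note si = succ_index[OF ij(1) True]
    have "(nilp * (nilp_transpose * nilp)) $$ (i, j) = (nilp_transpose * nilp) $$ (Suc i, j)"
      using nilp_mult_index[OF c ij] True by simp
    also have "\<dots> = (if ps j = 0 then 0 else nilp_transpose $$ (Suc i, j - 1))"
      by (rule mult_nilp_index[OF nilp_carrier(2) si(1) ij(2)])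
    also have "\<dots> = nilp $$ (i, j)"
    proof (cases "ps j = 0")
      case z: True
      then have "j \<noteq> Suc i" using si by auto
      then show ?thesis using z ij by (simp add: nilp_def)
    next
      case nz: False
      then have pj: "0 < ps j" by simp
      note pj = pred_index[OF ij(2) pj]
      have "nilp_transpose $$ (Suc i, j - 1) = (if Suc i = j then 1 else 0)"
        using si(1) pj by (simp add: nilp_transpose_def)
      then show ?thesis using nz True ij by (auto simp: nilp_def)
    qed
    finally show ?thesis .
  qed
qed (auto simp: nilp_def)

abbreviation "M \<equiv> add_monoid (ring_mat TYPE('r) n ())"

lemma comm_group_M: "comm_group M"
  by (rule abelian_group.a_comm_group[OF ring.is_abelian_group[OF ring_ring_mat]])

lemma mult_hom_M:
  assumes f: "f \<in> hom G M" and p: "p \<in> carrier_mat n n"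
  shows "(\<lambda>z. p * f z) \<in> hom G M" "(\<lambda>z. f z * p) \<in> hom G M"
proof -
  have c: "f z \<in> carrier_mat n n" if "z \<in> carrier G" for z
    using hom_in_carrier[OF f that] by (simp add: ring_mat_simps)
  have add: "f (z \<otimes>\<^bsub>G\<^esub> w) = f z + f w" if "z \<in> carrier G" "w \<in> carrier G" for z w
    using Group.hom_mult[OF f that] by (simp add: ring_mat_simps)
  show "(\<lambda>z. p * f z) \<in> hom G M"
  proof (rule homI)
    fix z assume "z \<in> carrier G" then show "p * f z \<in> carrier M"
      using mult_carrier_mat[OF p c] by (simp add: ring_mat_simps)
  next
    fix z w assume zw: "z \<in> carrier G" "w \<in> carrier G"
    show "p * f (z \<otimes>\<^bsub>G\<^esub> w) = (p * f z) \<otimes>\<^bsub>M\<^esub> (p * f w)"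
      using mult_add_distrib_mat[OF p c[OF zw(1)] c[OF zw(2)]] add[OF zw] by (simp add: ring_mat_simps)
  qed
  show "(\<lambda>z. f z * p) \<in> hom G M"
  proof (rule homI)
    fix z assume "z \<in> carrier G" then show "f z * p \<in> carrier M"
      using mult_carrier_mat[OF c p] by (simp add: ring_mat_simps)
  next
    fix z w assume zw: "z \<in> carrier G" "w \<in> carrier G"
    show "f (z \<otimes>\<^bsub>G\<^esub> w) * p = (f z * p) \<otimes>\<^bsub>M\<^esub> (f w * p)"
      using add_mult_distrib_mat[OF c[OF zw(1)] c[OF zw(2)] p] add[OF zw] by (simp add: ring_mat_simps)
  qed
qed

text \<open>The map \<open>x \<otimes> y \<mapsto> x N' y\<close>, with \<open>N'\<close> the transpose of \<open>N\<close>, is balanced because the entries of \<open>N'\<close> are 0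
and 1. It sends a separability element to a matrix \<open>T\<close> that commutes with \<open>N\<close> and satisfies \<open>N T N = N\<close>.\<close>

proposition size_one_if_separable:
  assumes sep: "separable_extension class_ring A (scalar_matrix n)" and i: "i < n"
  shows "sz i = 1"
proof (rule ccontr)
  assume "sz i \<noteq> 1"
  then have big: "1 < sz i" using block[OF i] by linarith
  obtain e where e: "e \<in> carrier ext.pair_group" and mu: "ext.mu e = \<one>\<^bsub>A\<^esub>"
    and cas: "\<And>a. a \<in> carrier A \<Longrightarrow> ext.tensor_class (ext.act_left a e) = ext.tensor_class (ext.act_right a e)"
    using ext.separable_extensionE[OF sep] by blast
  define \<beta> where "\<beta> = (\<lambda>p. fst p * (nilp_transpose * snd p))"
  have mc: "p * q \<in> carrier_mat n n" if "p \<in> carrier_mat n n" "q \<in> carrier_mat n n" for p q :: "'r mat"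
    using that by (rule mult_carrier_mat)
  have ma: "p * q * r = p * (q * r)" if "p \<in> carrier_mat n n" "q \<in> carrier_mat n n" "r \<in> carrier_mat n n" for p q r :: "'r mat"
    using that by (rule assoc_mult_mat)
  note group_M = comm_group.axioms(2)[OF comm_group_M]
  have scal: "nilp_transpose * scalar_matrix n r = scalar_matrix n r * nilp_transpose" for r
  proof (rule eq_matI)
    fix i j assume "i < dim_row (scalar_matrix n r * nilp_transpose)" "j < dim_col (scalar_matrix n r * nilp_transpose)"
    then have ij: "i < n" "j < n" by (auto simp: scalar_matrix_def nilp_transpose_def)
    then show "(nilp_transpose * scalar_matrix n r) $$ (i, j) = (scalar_matrix n r * nilp_transpose) $$ (i, j)"
      using scalar_matrix_mult[OF nilp_carrier(2) ij] by (simp add: nilp_transpose_def)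
  qed (auto simp: scalar_matrix_def nilp_transpose_def)
  have \<beta>c: "\<beta> (x, y) \<in> carrier M" if "x \<in> carrier A" "y \<in> carrier A" for x y
    using that by (simp add: \<beta>_def ring_mat_simps mc carrier_A_mat)
  have bal: "ext.balanced M \<beta>"
    unfolding ext.balanced_def
  proof (intro conjI ballI)
    show "\<beta> \<in> carrier A \<times> carrier A \<rightarrow> carrier M" using \<beta>c by auto
  next
    fix x x' y assume "x \<in> carrier A" "x' \<in> carrier A" "y \<in> carrier A"
    then show "\<beta> (x \<oplus>\<^bsub>A\<^esub> x', y) = \<beta> (x, y) \<otimes>\<^bsub>M\<^esub> \<beta> (x', y)"
      by (simp add: \<beta>_def ring_mat_simps centralizer_algebra_simps(3) carrier_A_mat mc add_mult_distrib_mat[of _ n n _ _ n])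
  next
    fix x y y' assume "x \<in> carrier A" "y \<in> carrier A" "y' \<in> carrier A"
    then show "\<beta> (x, y \<oplus>\<^bsub>A\<^esub> y') = \<beta> (x, y) \<otimes>\<^bsub>M\<^esub> \<beta> (x, y')"
      by (simp add: \<beta>_def ring_mat_simps centralizer_algebra_simps(3) carrier_A_mat mc mult_add_distrib_mat[of _ n n _ n])
  next
    fix x b y assume c: "x \<in> carrier A" "y \<in> carrier A"
    have "x * scalar_matrix n b * (nilp_transpose * y) = x * (scalar_matrix n b * nilp_transpose * y)"
      using c by (simp add: ma mc carrier_A_mat)
    also have "\<dots> = x * (nilp_transpose * (scalar_matrix n b * y))"
      using c by (simp add: scal[symmetric] ma mc carrier_A_mat)
    finally show "\<beta> (x \<otimes>\<^bsub>A\<^esub> scalar_matrix n b, y) = \<beta> (x, scalar_matrix n b \<otimes>\<^bsub>A\<^esub> y)"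
      by (simp add: \<beta>_def centralizer_algebra_simps(2))
  qed
  define T where "T = ext.lift M \<beta>"
  have Thom: "T \<in> hom ext.pair_group M"
    unfolding T_def using bal by (intro ext.lift_hom comm_group_M) (simp add: ext.balanced_def)
  have Tc: "T z \<in> carrier_mat n n" if "z \<in> carrier ext.pair_group" for z
    using hom_in_carrier[OF Thom that] by (simp add: ring_mat_simps)
  have Tf: "T (frag_of (x, y)) = x * (nilp_transpose * y)" if "x \<in> carrier A" "y \<in> carrier A" for x y
    unfolding T_def using ext.lift_frag_of[OF comm_group_M, of \<beta> "(x, y)"] \<beta>c[OF that] by (simp add: \<beta>_def)
  have Ta: "T (ext.act_left a z) = a * T z" "T (ext.act_right a z) = T z * a"
    if a: "a \<in> carrier A" and z: "z \<in> carrier ext.pair_group" for a z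
  proof -
    show "T (ext.act_left a z) = a * T z"
      by (rule ext.hom_eq_on_generators[OF group_M _ mult_hom_M(1)[OF Thom carrier_A_mat[OF a]] _ z, where f = "\<lambda>z. T (ext.act_left a z)"])
        (use Group.hom_compose[OF ext.act_left_hom[OF a] Thom] a in
          \<open>auto simp: comp_def Tf centralizer_algebra_simps(2) carrier_A_mult ma mc carrier_A_mat\<close>)
    show "T (ext.act_right a z) = T z * a"
      by (rule ext.hom_eq_on_generators[OF group_M _ mult_hom_M(2)[OF Thom carrier_A_mat[OF a]] _ z, where f = "\<lambda>z. T (ext.act_right a z)"])
        (use Group.hom_compose[OF ext.act_right_hom[OF a] Thom] a in
          \<open>auto simp: comp_def Tf centralizer_algebra_simps(2) carrier_A_mult ma mc carrier_A_mat\<close>)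
  qed
  have Tclass: "T z = T w" if zw: "z \<in> carrier ext.pair_group" "w \<in> carrier ext.pair_group" "ext.tensor_class z = ext.tensor_class w" for z w
  proof -
    have bal': "ext.balanced M (\<lambda>p. T (frag_of p))" unfolding T_def by (rule ext.balanced_lift[OF comm_group_M bal])
    have "T z = the_elem (T ` ext.tensor_class z)"
      by (rule ext.the_elem_balanced_image[OF group_M Thom bal' zw(1), symmetric])
    also have "\<dots> = T w" unfolding zw(3) by (rule ext.the_elem_balanced_image[OF group_M Thom bal' zw(2)])
    finally show ?thesis .
  qed
  have nA: "nilp \<in> carrier A"
    unfolding mem_carrier_A_iff
  proof (intro conjI allI impI nilp_carrier)
    fix i j assume "i < n" "j < n" "ev i \<noteq> ev j"
    then show "nilp $$ (i, j) = 0" using succ_index[of i] by (auto simp: nilp_def)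
  next
    fix i j assume ij: "i < n" "j < n"
    show "(if ps j = 0 then 0 else nilp $$ (i, j - 1)) = (if Suc (ps i) < sz i then nilp $$ (Suc i, j) else 0)"
      using nilp_mult_index[OF nilp_carrier(1) ij] mult_nilp_index[OF nilp_carrier(1) ij] by simp
  qed
  have comm: "a * T e = T e * a" if "a \<in> carrier A" for a
  proof -
    have "ext.act_left a e \<in> carrier ext.pair_group" "ext.act_right a e \<in> carrier ext.pair_group"
      using hom_in_carrier[OF ext.act_left_hom[OF that] e] hom_in_carrier[OF ext.act_right_hom[OF that] e] by auto
    then show ?thesis using Tclass[OF _ _ cas[OF that]] Ta[OF that e] by simp
  qed
  have "nilp * (T z * nilp) = nilp * ext.mu z" if z: "z \<in> carrier ext.pair_group" for z
  proof (rule ext.hom_eq_on_generators[OF group_M _ _ _ z])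
    show "(\<lambda>z. nilp * (T z * nilp)) \<in> hom ext.pair_group M"
      using mult_hom_M(1)[OF mult_hom_M(2)[OF Thom]] by simp
    have "ext.mu \<in> hom ext.pair_group M"
      using ext.mu_hom carrier_A_mat by (auto simp: hom_def ring_mat_simps centralizer_algebra_simps(3))
    then show "(\<lambda>z. nilp * ext.mu z) \<in> hom ext.pair_group M" by (rule mult_hom_M(1)) simp
  next
    fix x y assume xy: "x \<in> carrier A" "y \<in> carrier A"
    have c: "x \<in> carrier_mat n n" "y \<in> carrier_mat n n" using xy carrier_A_mat by auto
    have "nilp * (T (frag_of (x, y)) * nilp) = nilp * x * nilp_transpose * (y * nilp)"
      unfolding Tf[OF xy] using c by (simp add: ma mc)
    also have "\<dots> = x * nilp * nilp_transpose * (nilp * y)"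
      using nilp_central xy by simp
    also have "\<dots> = x * (nilp * (nilp_transpose * nilp)) * y" using c by (simp add: ma mc)
    also have "\<dots> = nilp * (x * y)" unfolding nilp_partial_isometry nilp_central[OF xy(1)] using c by (simp add: ma mc)
    finally show "nilp * (T (frag_of (x, y)) * nilp) = nilp * ext.mu (frag_of (x, y))"
      using ext.mu_frag_of[OF xy] by (simp add: centralizer_algebra_simps(2))
  qed
  from this[OF e] have key: "nilp * (nilp * T e) = nilp"
    using mu comm[OF nA] right_mult_one_mat[OF nilp_carrier(1)] by (simp only: centralizer_algebra_simps(4))
  \<comment> \<open>The last but one row of the block of \<open>i\<close>.\<close>
  define k where "k = i - ps i + (sz i - 2)"
  note h = head_index[OF i]
  have k: "k < n" "ps k = sz k - 2" "sz k = sz i"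
    using block_index[OF h(1,2), of "sz i - 2"] h big by (auto simp: k_def)
  have link: "Suc (ps k) < sz k" using k big by simp
  note sk = succ_index[OF k(1) link]
  have "(nilp * (nilp * T e)) $$ (k, Suc k) = (nilp * T e) $$ (Suc k, Suc k)"
    using nilp_mult_index[OF mc[OF nilp_carrier(1) Tc[OF e]] k(1) sk(1)] link by simp
  also have "\<dots> = 0"
  proof -
    have "\<not> Suc (ps (Suc k)) < sz (Suc k)" using sk k big by linarith
    then show ?thesis using nilp_mult_index[OF Tc[OF e] sk(1) sk(1)] by simp
  qed
  finally have "nilp $$ (k, Suc k) = 0" unfolding key .
  then show False using k(1) sk(1) link by (simp add: nilp_def)
qed

lemma finsum_A_index:
  assumes "finite I" "x \<in> I \<rightarrow> carrier A" "i < n" "j < n"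
  shows "(finsum A x I) $$ (i, j) = (\<Sum>k\<in>I. x k $$ (i, j))"
  using assms(1,2)
proof (induct rule: finite_induct)
  case empty
  then show ?case using assms(3,4) by (simp add: centralizer_algebra_simps(5))
next
  case (insert k I)
  have "finsum A x I \<in> carrier_mat n n" "x k \<in> carrier_mat n n"
    using insert carrier_A_mat ext.S.finsum_closed[of x I] by auto
  moreover have "finsum A x (insert k I) = x k + finsum A x I"
    using insert by (simp add: ext.S.finsum_insert centralizer_algebra_simps(3))
  ultimately show ?case using insert assms(3,4) by simp
qed

text \<open>Now \<open>A\<close> consists of all matrices without entries between distinct eigenvalues. With \<open>u\<^sub>i = E\<^bsub>i,\<rho>(i)\<^esub>\<close> and
\<open>v\<^sub>i = E\<^bsub>\<rho>(i),i\<^esub>\<close>, the product \<open>a u\<^sub>i\<close> is \<open>\<Sum>\<^sub>j u\<^sub>j a\<^sub>j\<^sub>i\<close> and \<open>v\<^sub>j a\<close> is \<open>\<Sum>\<^sub>i a\<^sub>j\<^sub>i v\<^sub>i\<close>, so that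
\<open>\<Sum>\<^sub>i a u\<^sub>i \<otimes> v\<^sub>i = \<Sum>\<^sub>j u\<^sub>j \<otimes> v\<^sub>j a\<close> by moving the scalars \<open>a\<^sub>j\<^sub>i\<close> across the tensor sign.\<close>

proposition separable_if_size_one:
  assumes one: "\<And>i. i < n \<Longrightarrow> sz i = 1"
  shows "separable_extension class_ring A (scalar_matrix n)"
proof -
  have ps0: "ps i = 0" if "i < n" for i using block[OF that] one[OF that] by simp
  have A_iff: "a \<in> carrier A \<longleftrightarrow> a \<in> carrier_mat n n \<and> (\<forall>i<n. \<forall>j<n. ev i \<noteq> ev j \<longrightarrow> a $$ (i, j) = 0)" for a
    unfolding mem_carrier_A_iff using ps0 one by auto
  \<comment> \<open>All indices with one eigenvalue share their representative, so the middle indices of the matrix units match.\<close>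
  define \<rho> where "\<rho> i = (LEAST j. j < n \<and> ev j = ev i)" for i
  have \<rho>: "\<rho> i < n" "ev (\<rho> i) = ev i" if "i < n" for i
    using LeastI[of "\<lambda>j. j < n \<and> ev j = ev i" i] that by (auto simp: \<rho>_def)
  have \<rho>_eq: "\<rho> i = \<rho> j" if "ev i = ev j" for i j using that by (simp add: \<rho>_def)
  have uA: "unit_mat n i j \<in> carrier A" if "i < n" "j < n" "ev i = ev j" for i j
    unfolding A_iff using that by (auto simp: unit_mat_index)
  let ?u = "\<lambda>i. unit_mat n i (\<rho> i) :: 'r mat" and ?v = "\<lambda>i. unit_mat n (\<rho> i) i :: 'r mat"
  have uv: "?u i \<in> carrier A" "?v i \<in> carrier A" if "i < n" for i using uA \<rho> that by auto
  define e where "e = (\<Sum>i<n. frag_of (?u i, ?v i))"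
  have eA: "e \<in> carrier ext.pair_group"
    unfolding e_def by (rule sum_closed_free_Abelian_group) (use uv in auto)
  have comb_c: "(\<lambda>j. ?u j * scalar_matrix n (f j)) \<in> {..<n} \<rightarrow> carrier A"
    "(\<lambda>j. scalar_matrix n (f j) * ?v j) \<in> {..<n} \<rightarrow> carrier A" for f
    using uv carrier_A_mult scalar_in_A by auto
  show ?thesis
  proof (rule ext.separable_extensionI)
    show "e \<in> carrier ext.pair_group" by (rule eA)
    have "ext.mu e = (\<Oplus>\<^bsub>A\<^esub>i\<in>{..<n}. ?u i \<otimes>\<^bsub>A\<^esub> ?v i)"
      unfolding e_def by (rule ext.mu_sum) (use uv in auto)
    also have "\<dots> = 1\<^sub>m n"
    proof (rule eq_matI)
      fix r s assume "r < dim_row (1\<^sub>m n :: 'r mat)" "s < dim_col (1\<^sub>m n :: 'r mat)"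
      then have rs: "r < n" "s < n" by auto
      have "(\<Oplus>\<^bsub>A\<^esub>i\<in>{..<n}. ?u i \<otimes>\<^bsub>A\<^esub> ?v i) $$ (r, s) = (\<Sum>i<n. (?u i * ?v i) $$ (r, s))"
        using finsum_A_index[of "{..<n}" "\<lambda>i. ?u i \<otimes>\<^bsub>A\<^esub> ?v i"] rs uv
        by (simp add: centralizer_algebra_simps(2) carrier_A_mult Pi_iff)
      also have "\<dots> = (\<Sum>i<n. if i = r then if r = s then 1 else 0 else 0)"
        using rs \<rho> by (intro sum.cong refl) (auto simp: unit_mat_mult(1) unit_mat_index)
      also have "\<dots> = 1\<^sub>m n $$ (r, s)" using rs by simp
      finally show "(\<Oplus>\<^bsub>A\<^esub>i\<in>{..<n}. ?u i \<otimes>\<^bsub>A\<^esub> ?v i) $$ (r, s) = 1\<^sub>m n $$ (r, s)" .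
    next
      have "(\<Oplus>\<^bsub>A\<^esub>i\<in>{..<n}. ?u i \<otimes>\<^bsub>A\<^esub> ?v i) \<in> carrier A"
        by (rule ext.S.finsum_closed) (use uv in auto)
      then show "dim_row (\<Oplus>\<^bsub>A\<^esub>i\<in>{..<n}. ?u i \<otimes>\<^bsub>A\<^esub> ?v i) = dim_row (1\<^sub>m n :: 'r mat)"
        "dim_col (\<Oplus>\<^bsub>A\<^esub>i\<in>{..<n}. ?u i \<otimes>\<^bsub>A\<^esub> ?v i) = dim_col (1\<^sub>m n :: 'r mat)"
        using carrier_A_mat by auto
    qed
    finally show "ext.mu e = \<one>\<^bsub>A\<^esub>" by (simp add: centralizer_algebra_simps(4))
  next
    fix a assume a: "a \<in> carrier A"
    have au: "a * ?u i = (\<Oplus>\<^bsub>A\<^esub>j\<in>{..<n}. ?u j * scalar_matrix n (a $$ (j, i)))" if i: "i < n" for i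
    proof (rule A_eqI)
      show "a * ?u i \<in> carrier A" using a uv i carrier_A_mult by blast
      show "(\<Oplus>\<^bsub>A\<^esub>j\<in>{..<n}. ?u j * scalar_matrix n (a $$ (j, i))) \<in> carrier A"
        by (rule ext.S.finsum_closed[OF comb_c(1)])
      fix r s assume rs: "r < n" "s < n"
      have "(\<Oplus>\<^bsub>A\<^esub>j\<in>{..<n}. ?u j * scalar_matrix n (a $$ (j, i))) $$ (r, s)
        = (\<Sum>j<n. (?u j * scalar_matrix n (a $$ (j, i))) $$ (r, s))"
        by (rule finsum_A_index[OF finite_lessThan comb_c(1) rs])
      also have "\<dots> = (\<Sum>j<n. if j = r then if s = \<rho> r then a $$ (r, i) else 0 else 0)"
        using rs \<rho> by (intro sum.cong refl) (auto simp: scalar_matrix_mult(2) unit_mat_index)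
      also have "\<dots> = (a * ?u i) $$ (r, s)"
        using rs i \<rho> a A_iff \<rho>_eq[of r i] unit_mat_mult(2)[OF carrier_A_mat[OF a] i \<rho>(1)[OF i] rs]
        by (cases "ev r = ev i") auto
      finally show "(a * ?u i) $$ (r, s) = (\<Oplus>\<^bsub>A\<^esub>j\<in>{..<n}. ?u j * scalar_matrix n (a $$ (j, i))) $$ (r, s)" by simp
    qed
    have va: "?v j * a = (\<Oplus>\<^bsub>A\<^esub>i\<in>{..<n}. scalar_matrix n (a $$ (j, i)) * ?v i)" if j: "j < n" for j
    proof (rule A_eqI)
      show "?v j * a \<in> carrier A" using a uv j carrier_A_mult by blast
      show "(\<Oplus>\<^bsub>A\<^esub>i\<in>{..<n}. scalar_matrix n (a $$ (j, i)) * ?v i) \<in> carrier A"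
        by (rule ext.S.finsum_closed[OF comb_c(2)])
      fix r s assume rs: "r < n" "s < n"
      have "(\<Oplus>\<^bsub>A\<^esub>i\<in>{..<n}. scalar_matrix n (a $$ (j, i)) * ?v i) $$ (r, s)
        = (\<Sum>i<n. (scalar_matrix n (a $$ (j, i)) * ?v i) $$ (r, s))"
        by (rule finsum_A_index[OF finite_lessThan comb_c(2) rs])
      also have "\<dots> = (\<Sum>i<n. if i = s then if r = \<rho> s then a $$ (j, s) else 0 else 0)"
        using rs \<rho> by (intro sum.cong refl) (auto simp: scalar_matrix_mult(1) unit_mat_index)
      also have "\<dots> = (?v j * a) $$ (r, s)"
        using rs j \<rho> a A_iff \<rho>_eq[of j s] unit_mat_mult(1)[OF carrier_A_mat[OF a] \<rho>(1)[OF j] j rs]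
        by (cases "ev j = ev s") auto
      finally show "(?v j * a) $$ (r, s) = (\<Oplus>\<^bsub>A\<^esub>i\<in>{..<n}. scalar_matrix n (a $$ (j, i)) * ?v i) $$ (r, s)" by simp
    qed
    let ?p = "\<lambda>i j. frag_of (?u j * scalar_matrix n (a $$ (j, i)), ?v i)"
    let ?q = "\<lambda>i j. frag_of (?u j, scalar_matrix n (a $$ (j, i)) * ?v i)"
    have L: "ext.act_left a e = (\<Sum>i<n. frag_of (a * ?u i, ?v i))"
      by (simp add: e_def ext.act_left_def frag_extend_sum comp_def centralizer_algebra_simps(2))
    have R: "ext.act_right a e = (\<Sum>j<n. frag_of (?u j, ?v j * a))"
      by (simp add: e_def ext.act_right_def frag_extend_sum comp_def centralizer_algebra_simps(2))
    have 1: "ext.act_left a e - (\<Sum>i<n. \<Sum>j<n. ?p i j) \<in> ext.relation_group"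
      unfolding L
    proof (rule ext.relation_group_sum)
      fix i assume "i \<in> {..<n}"
      then show "frag_of (a * ?u i, ?v i) - (\<Sum>j<n. ?p i j) \<in> ext.relation_group"
        using au ext.relation_group_finsum_left[OF finite_lessThan comb_c(1)] uv by simp
    qed
    have 2: "(\<Sum>i<n. \<Sum>j<n. ?p i j) - (\<Sum>i<n. \<Sum>j<n. ?q i j) \<in> ext.relation_group"
      using ext.relation_group_middle uv
      by (intro ext.relation_group_sum) (auto simp: centralizer_algebra_simps(2))
    have 3: "(\<Sum>j<n. \<Sum>i<n. ?q i j) - ext.act_right a e \<in> ext.relation_group"
      unfolding R
    proof (rule ext.relation_group_sum)
      fix j assume "j \<in> {..<n}"
      then show "(\<Sum>i<n. ?q i j) - frag_of (?u j, ?v j * a) \<in> ext.relation_group"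
        using va ext.relation_group_diff_swap[OF ext.relation_group_finsum_right[OF finite_lessThan comb_c(2)]] uv by simp
    qed
    have "ext.act_left a e - ext.act_right a e \<in> ext.relation_group"
      using ext.relation_group_add[OF ext.relation_group_add[OF 1 2]] 3
      unfolding sum.swap[of "\<lambda>i j. ?q i j" "{..<n}" "{..<n}"] by fastforce
    then show "ext.tensor_class (ext.act_left a e) = ext.tensor_class (ext.act_right a e)"
      by (rule ext.tensor_class_eqI[OF hom_in_carrier[OF ext.act_left_hom[OF a] eA]
            hom_in_carrier[OF ext.act_right_hom[OF a] eA]])
  qed
qed

end

section \<open>Flattening a list of Jordan blocks\<close>

text \<open>One entry per row of the Jordan matrix: the position in the block, the size and the eigenvalue.\<close>

definition cells :: "(nat \<times> 'k) list \<Rightarrow> (nat \<times> nat \<times> 'k) list" where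
  "cells blocks = concat (map (\<lambda>(m, l). map (\<lambda>p. (p, m, l)) [0..<m]) blocks)"

lemma cells_Nil [simp]: "cells [] = []"
  and cells_Cons: "cells ((m, l) # bs) = map (\<lambda>p. (p, m, l)) [0..<m] @ cells bs"
  by (simp_all add: cells_def)

lemma length_cells [simp]: "length (cells blocks) = sum_list (map fst blocks)"
  by (induct blocks) (auto simp: cells_Cons)

lemma cells_nth_Cons:
  "cells ((m, l) # bs) ! i = (if i < m then (i, m, l) else cells bs ! (i - m))"
  by (simp add: cells_Cons nth_append)

lemma cells_nth:
  assumes "i < sum_list (map fst blocks)" "cells blocks ! i = (p, m, l)"
  shows "p \<le> i" "p < m" "i - p + m \<le> sum_list (map fst blocks)"
    "k < m \<Longrightarrow> cells blocks ! (i - p + k) = (k, m, l)"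
proof -
  have "p \<le> i \<and> p < m \<and> i - p + m \<le> sum_list (map fst blocks) \<and>
    (\<forall>k<m. cells blocks ! (i - p + k) = (k, m, l))"
    using assms
  proof (induct blocks arbitrary: i)
    case Nil then show ?case by simp
  next
    case (Cons b bs)
    obtain m' l' where b: "b = (m', l')" by (cases b)
    show ?case
    proof (cases "i < m'")
      case True
      then have "p = i" "m = m'" "l = l'" using Cons(3) by (auto simp: b cells_nth_Cons)
      then show ?thesis using True by (auto simp: b cells_nth_Cons)
    next
      case False
      define i' where "i' = i - m'"
      have i: "i = m' + i'" using False by (simp add: i'_def)
      have "p \<le> i' \<and> p < m \<and> i' - p + m \<le> sum_list (map fst bs) \<and> (\<forall>k<m. cells bs ! (i' - p + k) = (k, m, l))"
        using Cons(2,3) by (intro Cons(1)) (auto simp: b i cells_nth_Cons)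
      then show ?thesis by (auto simp: b i cells_nth_Cons)
    qed
  qed
  then show "p \<le> i" "p < m" "i - p + m \<le> sum_list (map fst blocks)"
    "k < m \<Longrightarrow> cells blocks ! (i - p + k) = (k, m, l)" by auto
qed

lemma set_cells: "set (cells blocks) = {(p, m, l). (m, l) \<in> set blocks \<and> p < m}"
  by (induct blocks) (auto simp: cells_Cons)

lemma jordan_matrix_index:
  assumes "i < sum_list (map fst blocks)" "j < sum_list (map fst blocks)"
    and "cells blocks ! i = (p, m, l)"
  shows "jordan_matrix blocks $$ (i, j) = (if i = j then l else if j = Suc i \<and> Suc p < m then 1 else 0)"
  using assms
proof (induct blocks arbitrary: i j)
  case Nil then show ?case by simp
next
  case (Cons b bs)
  obtain m' l' where b: "b = (m', l')" by (cases b)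
  let ?s = "sum_list (map fst bs)"
  have ij: "i < m' + ?s" "j < m' + ?s" using Cons(2,3) by (auto simp: b)
  have idx: "jordan_matrix (b # bs) $$ (i, j) =
    (if i < m' then if j < m' then jordan_block m' l' $$ (i, j) else 0
     else if j < m' then 0 else jordan_matrix bs $$ (i - m', j - m'))"
    unfolding b jordan_matrix_Cons using ij by (subst index_mat_four_block(1)) auto
  show ?case
  proof (cases "i < m'")
    case True
    then have "p = i" "m = m'" "l = l'" using Cons(4) by (auto simp: b cells_nth_Cons)
    then show ?thesis unfolding idx using True by auto
  next
    case False
    show ?thesis
    proof (cases "j < m'")
      case True then show ?thesis unfolding idx using False by auto
    next
      case j: False
      have "jordan_matrix bs $$ (i - m', j - m') =
        (if i - m' = j - m' then l else if j - m' = Suc (i - m') \<and> Suc p < m then 1 else 0)"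
        using Cons(4) False j ij by (intro Cons(1)) (auto simp: b cells_nth_Cons)
      moreover have "i - m' = j - m' \<longleftrightarrow> i = j" "j - m' = Suc (i - m') \<longleftrightarrow> j = Suc i"
        using False j by linarith+
      ultimately show ?thesis unfolding idx using False j by (simp only: if_False)
    qed
  qed
qed

theorem theorem1p1:
  fixes \<eta> :: "'k::idom \<Rightarrow> 'r::ring_1"
    and n :: nat
    and blocks :: "(nat \<times> 'k) list"
    and c :: "'r mat"
  assumes algebra: "algebra_structure_map \<eta>"
    and regular: "\<And>l l' x. l \<in> snd ` set blocks \<Longrightarrow> l' \<in> snd ` set blocks \<Longrightarrow> l \<noteq> l' \<Longrightarrow>
      \<eta> (l - l') * x = 0 \<Longrightarrow> x = 0"
    and sizes_pos: "\<And>m l. (m, l) \<in> set blocks \<Longrightarrow> 0 < m"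
    and sizes_sum: "sum_list (map fst blocks) = n"
    and c_def: "c = jordan_matrix (map (\<lambda>(m, l). (m, \<eta> l)) blocks)"
  shows "(frobenius_extension (class_ring :: 'r ring) (centralizer_algebra n c) (scalar_matrix n)
        \<longleftrightarrow> (\<forall>i<length blocks. \<forall>j<length blocks.
              snd (blocks ! i) = snd (blocks ! j) \<longrightarrow> fst (blocks ! i) = fst (blocks ! j)))
    \<and> ((\<forall>m\<in>{1..n}. (of_nat m :: 'r) \<in> Units (class_ring :: 'r ring)) \<longrightarrow>
        (separable_frobenius_extension
            (class_ring :: 'r ring) (centralizer_algebra n c) (scalar_matrix n)
          \<longleftrightarrow> (\<forall>i<length blocks. fst (blocks ! i) = 1)))"
proof -
  define bs where "bs = map (\<lambda>(m, l). (m, \<eta> l)) blocks"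
  have eta_add: "\<eta> (a + b) = \<eta> a + \<eta> b" and eta_central: "\<eta> a * x = x * \<eta> a" for a b x
    using algebra by (auto simp: algebra_structure_map_def ring_hom_def)
  have eta_diff: "\<eta> (a - b) = \<eta> a - \<eta> b" for a b
    using eta_add[of "a - b" b] by (simp add: eq_diff_eq)
  \<comment> \<open>The regularity hypothesis, applied to 1, keeps distinct eigenvalues distinct in \<open>R\<close>.\<close>
  have eta_inj: "l = l'" if "l \<in> snd ` set blocks" "l' \<in> snd ` set blocks" "\<eta> l = \<eta> l'" for l l'
    using regular[OF that(1,2), of 1] that(3) by (auto simp: eta_diff)
  have sum: "sum_list (map fst bs) = n"
    using sizes_sum by (simp add: bs_def comp_def case_prod_unfold)
  have set_bs: "set bs = (\<lambda>(m, l). (m, \<eta> l)) ` set blocks" by (simp add: bs_def)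
  define ps sz ev where "ps i = fst (cells bs ! i)" and "sz i = fst (snd (cells bs ! i))"
    and "ev i = snd (snd (cells bs ! i))" for i
  have cell: "cells bs ! i = (ps i, sz i, ev i)" for i by (simp add: ps_def sz_def ev_def)
  have range: "{(sz i, ev i) | i. i < n} = set bs"
  proof -
    have "set (cells bs) = {(ps i, sz i, ev i) | i. i < n}"
      using cell by (auto simp: set_conv_nth sum)
    then have "{(sz i, ev i) | i. i < n} = snd ` set (cells bs)" by force
    also have "\<dots> = set bs" using sizes_pos by (force simp: set_cells set_bs)
    finally show ?thesis .
  qed
  have ball_bs: "(\<forall>b\<in>set bs. P b) \<longleftrightarrow> (\<forall>i<n. P (sz i, ev i))" for P
    unfolding range[symmetric] by blast
  have ev_eta: "\<exists>l\<in>snd ` set blocks. ev i = \<eta> l" if "i < n" for i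
  proof -
    have "(sz i, ev i) \<in> set bs" using range that by blast
    then show ?thesis by (force simp: set_bs)
  qed
  interpret jordan_layout n ps sz ev c
  proof
    fix i assume i: "i < n"
    then have i': "i < sum_list (map fst bs)" by (simp add: sum)
    show "ps i \<le> i \<and> ps i < sz i \<and> i - ps i + sz i \<le> n"
      using cells_nth(1-3)[OF i' cell] sum by simp
    show "ps (i - ps i + k) = k \<and> sz (i - ps i + k) = sz i \<and> ev (i - ps i + k) = ev i" if "k < sz i" for k
      using cells_nth(4)[OF i' cell that] cell[of "i - ps i + k"] by simp
    show "ev i * x = x * ev i" for x using ev_eta[OF i] eta_central by auto
  next
    show "c = mat n n (\<lambda>(i, j). if i = j then ev i else if j = Suc i \<and> Suc (ps i) < sz i then 1 else 0)"
    proof (rule eq_matI)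
      fix i j assume "i < dim_row (mat n n (\<lambda>(i, j). if i = j then ev i else if j = Suc i \<and> Suc (ps i) < sz i then 1 else 0))"
        "j < dim_col (mat n n (\<lambda>(i, j). if i = j then ev i else if j = Suc i \<and> Suc (ps i) < sz i then 1 else 0))"
      then have "i < n" "j < n" by auto
      then show "c $$ (i, j) = mat n n (\<lambda>(i, j). if i = j then ev i else if j = Suc i \<and> Suc (ps i) < sz i then 1 else 0) $$ (i, j)"
        using jordan_matrix_index[OF _ _ cell] by (simp add: sum c_def flip: bs_def)
    qed (simp_all add: sum c_def flip: bs_def)
  next
    fix i j x assume "i < n" "j < n" "ev i \<noteq> ev j" "(ev i - ev j) * x = 0"
    then show "x = 0" using ev_eta[of i] ev_eta[of j] regular by (metis eta_diff)
  qed
  have sizes_iff: "(\<forall>i<length blocks. \<forall>j<length blocks.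
      snd (blocks ! i) = snd (blocks ! j) \<longrightarrow> fst (blocks ! i) = fst (blocks ! j))
    \<longleftrightarrow> (\<forall>i<n. \<forall>j<n. ev i = ev j \<longrightarrow> sz i = sz j)"
  proof -
    have "(\<forall>i<length blocks. \<forall>j<length blocks.
        snd (blocks ! i) = snd (blocks ! j) \<longrightarrow> fst (blocks ! i) = fst (blocks ! j))
      \<longleftrightarrow> (\<forall>b\<in>set blocks. \<forall>b'\<in>set blocks. snd b = snd b' \<longrightarrow> fst b = fst b')"
      by (simp add: all_set_conv_all_nth)
    also have "\<dots> \<longleftrightarrow> (\<forall>b\<in>set blocks. \<forall>b'\<in>set blocks. \<eta> (snd b) = \<eta> (snd b') \<longrightarrow> fst b = fst b')"
      using eta_inj by (metis imageI)
    also have "\<dots> \<longleftrightarrow> (\<forall>b\<in>set bs. \<forall>b'\<in>set bs. snd b = snd b' \<longrightarrow> fst b = fst b')"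
      by (simp add: set_bs case_prod_unfold)
    also have "\<dots> \<longleftrightarrow> (\<forall>i<n. \<forall>j<n. ev i = ev j \<longrightarrow> sz i = sz j)"
      by (simp add: ball_bs)
    finally show ?thesis .
  qed
  have ones_iff: "(\<forall>i<length blocks. fst (blocks ! i) = 1) \<longleftrightarrow> (\<forall>i<n. sz i = 1)"
  proof -
    have "(\<forall>i<length blocks. fst (blocks ! i) = 1) \<longleftrightarrow> (\<forall>b\<in>set bs. fst b = 1)"
      by (auto simp: all_set_conv_all_nth set_bs case_prod_unfold)
    also have "\<dots> \<longleftrightarrow> (\<forall>i<n. sz i = 1)" by (simp add: ball_bs)
    finally show ?thesis .
  qed
  have frob: "frobenius_extension class_ring A (scalar_matrix n) \<longleftrightarrow> (\<forall>i<n. \<forall>j<n. ev i = ev j \<longrightarrow> sz i = sz j)"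
    using frobenius_if_equal_sizes no_smaller_block_if_frobenius by (metis linorder_neqE_nat)
  have sep: "separable_extension class_ring A (scalar_matrix n) \<longleftrightarrow> (\<forall>i<n. sz i = 1)"
    using separable_if_size_one size_one_if_separable by blast
  show ?thesis
    unfolding separable_frobenius_extension_def sizes_iff ones_iff frob sep by auto
qed

end
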